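(* Let $(X,d)$ be a separable, directionally limited metric space endowed with an asymptotically $(\alpha,\gamma)$-bounded measure $\nu$, for some constants $\alpha\in(0,1]$ and $\gamma\ge 1$. Let $\mu$ be a positive Borel measure on $X$ and let $q$ be a premeasure defined on the closed balls of $X$ such that, for some constants $C\ge 1$ and $r_0>0$ (and with the same $\alpha$), $$C^{-1}\mu(B_{\alpha r}(x))\le q(B_r(x))\le C\,\mu(B_r(x))\qquad\text{for all }x\in X\text{ and all }0<r<r_0 .$$ Let $\hat\mu^{q}$ be the set function obtained from $q$ by the packing construction. Then: 1. for every Borel set $A\subset X$, $$\frac{1}{\gamma C}\,\mu(A)\le \hat\mu^{q}(A)\le C\,\inf\{\mu(U) : A\subset U,\ U\text{ open}\};$$ 2. $\hat\mu^{q}$ is countably sub-additive and is a metric outer measure; 3. if moreover $\mu$ is outer regular (i.e. $\mu(A)=\inf\{\mu(U): A\subset U,\ U\text{ open}\}$ for every Borel set $A$), then $\mu$ and the positive Borel measure associated with the outer measure $\hat\mu^{q}$ (its restriction to Borel sets, still denoted $\hat\mu^q$) are equivalent, and more precisely $\frac{1}{\gamma C}\,\mu\le\hat\mu^{q}\le C\mu$.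
   Context: Balls: $B_r(x)=\{y\in X: d(x,y)\le r\}$ is the closed ball and $U_r(x)=\{y\in X: d(x,y)<r\}$ the open ball, $r>0$. Directionally limited: let $\xi>0$, $0<\eta\le\frac13$, $\zeta\in\{1,2,\dots\}$ and $A\subset X$. The distance $d$ is directionally $(\xi,\eta,\zeta)$-limited at $A$ if, for every $a\in A$ and every $B\subset A\cap(U_\xi(a)\setminus\{a\})$ with the property that for all $b,c\in B$ with $b\ne c$ and $d(a,b)\ge d(a,c)$ and all $x\in X$ with $d(a,x)=d(a,c)$ and $d(a,x)+d(x,b)=d(a,b)$ one has $\frac{d(x,c)}{d(a,c)}\ge\eta$, it holds that $\operatorname{card}B\le\zeta$. $(X,d)$ is directionally limited if $d$ is directionally $(\xi,\eta,\zeta)$-limited at $X$ for some such $(\xi,\eta,\zeta)$. Asymptotically $(\alpha,\gamma)$-bounded measure: a positive Borel measure $\nu$ on $X$ that is finite on bounded sets, strictly positive on every ball of positive radius, and such that $\limsup_{r\to0^+}\frac{\nu(B_r(x))}{\nu(B_{\alpha r}(x))}\le\gamma$ for all $x\in X$. Premeasure: a nonnegative (possibly $+\infty$-valued) function $q$ defined on the family of closed balls of $X$ together with $\emptyset$, with $q(\emptyset)=0$. Packing construction: for $U\subset X$ open and $\delta>0$, a packing of $U$ of order $\delta$ is a countable family of pairwise disjoint closed balls of radius less than $\delta$ whose union is contained in $U$. Set $\hat\mu^q_\delta(U)=\sup\{\sum_{B\in\mathcal F}q(B): \mathcal F\text{ is a packing of }U\text{ of order }\delta\}$, $\hat\mu^q(U)=\lim_{\delta\to0}\hat\mu^q_\delta(U)=\inf_{\delta>0}\hat\mu^q_\delta(U)$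 for $U$ open, and $\hat\mu^q(A)=\inf\{\hat\mu^q(U): A\subset U,\ U\text{ open}\}$ for every $A\subset X$. An outer measure on $X$ is a monotone, countably sub-additive set function $\mathcal P(X)\to[0,+\infty]$ vanishing on $\emptyset$; it is a metric outer measure if it is additive on pairs $E,F\subset X$ with $d(E,F)>0$ (then Borel sets are Carathéodory measurable). *)

theory Defs
  imports "HOL-Analysis.Analysis"
begin

definition directionally_limited_at :: "real \<Rightarrow> real \<Rightarrow> nat \<Rightarrow> 'a::metric_space set \<Rightarrow> bool" where
  "directionally_limited_at \<xi> \<eta> \<zeta> A \<longleftrightarrow>
    (\<forall>a\<in>A. \<forall>B. B \<subseteq> A \<inter> (ball a \<xi> - {a}) \<longrightarrow>
      (\<forall>b\<in>B. \<forall>c\<in>B. \<forall>x. b \<noteq> c \<longrightarrow> dist a b \<ge> dist a c \<longrightarrow>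
          dist a x = dist a c \<longrightarrow> dist a x + dist x b = dist a b \<longrightarrow>
          dist x c / dist a c \<ge> \<eta>) \<longrightarrow>
      finite B \<and> card B \<le> \<zeta>)"

definition directionally_limited :: "'a::metric_space itself \<Rightarrow> bool" where
  "directionally_limited _ \<longleftrightarrow>
    (\<exists>\<xi> \<eta> \<zeta>. 0 < \<xi> \<and> 0 < \<eta> \<and> \<eta> \<le> 1/3 \<and> 1 \<le> \<zeta> \<and>
      directionally_limited_at \<xi> \<eta> \<zeta> (UNIV :: 'a set))"

(* The second and third conditions keep numerator and denominator of the quotient in
   (0, \<infinity>), so the conventions for division on ennreal play no role. *)
definition asymptotically_bounded_measure ::
    "real \<Rightarrow> real \<Rightarrow> 'a::metric_space measure \<Rightarrow> bool" where
  "asymptotically_bounded_measure \<alpha> \<gamma> \<nu> \<longleftrightarrow>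
    sets \<nu> = sets borel \<and>
    (\<forall>A\<in>sets borel. bounded A \<longrightarrow> emeasure \<nu> A < \<infinity>) \<and>
    (\<forall>x. \<forall>r>0. 0 < emeasure \<nu> (cball x r)) \<and>
    (\<forall>x. Limsup (at_right 0) (\<lambda>r. emeasure \<nu> (cball x r) / emeasure \<nu> (cball x (\<alpha> * r)))
            \<le> ennreal \<gamma>)"

(* Only the values of q on closed balls and on {} are ever used below; its values on other
   sets are an artefact of totality. *)
definition premeasure :: "('a::metric_space set \<Rightarrow> ennreal) \<Rightarrow> bool" where
  "premeasure q \<longleftrightarrow> q {} = 0"

(* Balls are nonempty, so a pairwise disjoint family of balls has no repetitions and is
   the same thing as a disjoint set of balls.  A ball may have several centres and radii as
   a set; one radius below \<delta> suffices. *)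
definition packing :: "'a::metric_space set \<Rightarrow> real \<Rightarrow> 'a set set \<Rightarrow> bool" where
  "packing U \<delta> F \<longleftrightarrow>
    countable F \<and> disjoint F \<and>
    (\<forall>B\<in>F. \<exists>x r. 0 < r \<and> r < \<delta> \<and> B = cball x r) \<and> \<Union>F \<subseteq> U"

definition packing_size ::
    "('a::metric_space set \<Rightarrow> ennreal) \<Rightarrow> real \<Rightarrow> 'a set \<Rightarrow> ennreal" where
  "packing_size q \<delta> U = (SUP F\<in>{F. packing U \<delta> F}. \<Sum>\<^sub>\<infinity>B\<in>F. q B)"

(* packing_size q \<delta> U is nondecreasing in \<delta>, so the infimum is the limit as \<delta> tends to 0. *)
definition packing_open :: "('a::metric_space set \<Rightarrow> ennreal) \<Rightarrow> 'a set \<Rightarrow> ennreal" where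
  "packing_open q U = (INF \<delta>\<in>{0<..}. packing_size q \<delta> U)"

(* packing_open q is monotone, so on open sets this agrees with packing_open q. *)
definition packing_measure :: "('a::metric_space set \<Rightarrow> ennreal) \<Rightarrow> 'a set \<Rightarrow> ennreal" where
  "packing_measure q A = (INF U\<in>{U. open U \<and> A \<subseteq> U}. packing_open q U)"

(* setdist is 0 when one of the sets is empty; additivity is trivial in that case. *)
definition metric_outer_measure :: "('a::metric_space set \<Rightarrow> ennreal) \<Rightarrow> bool" where
  "metric_outer_measure m \<longleftrightarrow>
    outer_measure_space UNIV m \<and>
    (\<forall>E F. setdist E F > 0 \<longrightarrow> m (E \<union> F) = m E + m F)"

definition outer_regular_measure :: "'a::metric_space measure \<Rightarrow> bool" where
  "outer_regular_measure \<mu> \<longleftrightarrow>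
    (\<forall>A\<in>sets borel. emeasure \<mu> A = (INF U\<in>{U. open U \<and> A \<subseteq> U}. emeasure \<mu> U))"

definition borel_restriction :: "('a::metric_space set \<Rightarrow> ennreal) \<Rightarrow> 'a measure" where
  "borel_restriction m = measure_of UNIV (sets borel) m"

end

theory Submission
  imports Defs
begin

text \<open>
  Directional limitedness gives a Besicovitch covering theorem with \<open>2\<zeta> + 1\<close> disjoint subfamilies,
  hence a Vitali theorem: an open set of finite \<open>\<mu>\<close>-measure is exhausted by finite disjoint families
  taken from any fine family of closed balls. If \<open>\<mu>(B\<^sub>r) > g \<mu>(B\<^bsub>\<alpha>r\<^esub>)\<close> for some \<open>g > \<gamma>\<close> and all small \<open>r\<close>,
  then comparison with \<open>\<nu>\<close> forces \<open>\<mu>(B\<^sub>r) / \<nu>(B\<^sub>r)\<close> to tend to 0 along \<open>r = \<alpha>\<^sup>k r\<^sub>0\<close>, and by the covering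
  theorem the centres of such balls form a \<open>\<mu>\<close>-null set. So almost every point is the centre of
  arbitrarily small balls with \<open>\<mu>(B\<^sub>r) \<le> g C q(B\<^sub>r)\<close>, and packing with these gives
  \<open>\<mu>(U) \<le> \<gamma> C\<close> times the packing size of any open \<open>U\<close>. In particular an open set of finite packing
  size has finite \<open>\<mu>\<close>-measure; the balls of a fine packing that are missed when \<open>U\<close> is split into open
  pieces, or when a neighbourhood of a closed set is removed, lie in sets whose \<open>\<mu>\<close>-measure tends
  to 0. This yields countable sub-additivity and the Caratheodory property of closed sets.
\<close>

subsection \<open>Besicovitch covering\<close>

text \<open>Lindeloef property: the balls with centre in a countable dense set and radius
  \<open>1 / Suc n\<close> that fit into some \<open>V x\<close> are countably many and already
  cover \<open>A\<close>; one \<open>x\<close> is chosen for each of them.\<close>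

lemma separable_countable_subcover:
  fixes V :: "'a::metric_space \<Rightarrow> 'a set"
  assumes sep: "separable_space (euclidean :: 'a topology)"
    and V: "\<And>x. x \<in> A \<Longrightarrow> open (V x) \<and> x \<in> V x"
  obtains S where "S \<subseteq> A" "countable S" "A \<subseteq> (\<Union>x\<in>S. V x)"
proof -
  obtain D :: "'a set" where D: "countable D" "closure D = UNIV"
    using sep by (auto simp: separable_space_def)
  define P where "P = (\<lambda>(d, n::nat) x. x \<in> A \<and> ball d (1 / Suc n) \<subseteq> V x)"
  define I where "I = {p \<in> D \<times> UNIV. \<exists>x. P p x}"
  define f where "f p = (SOME x. P p x)" for p
  have f: "P p (f p)" if "p \<in> I" for p
    using that unfolding I_def f_def by (auto intro: someI_ex)
  have "A \<subseteq> (\<Union>x\<in>f ` I. V x)"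
  proof
    fix x assume "x \<in> A"
    then obtain e where e: "0 < e" "ball x e \<subseteq> V x"
      using V openE by blast
    then obtain n where n: "inverse (Suc n) < e / 2"
      using reals_Archimedean[of "e/2"] by auto
    obtain d where d: "d \<in> D" "dist d x < 1 / Suc n"
      using D(2) closure_approachableD[of x D "1 / Suc n"]
      by (auto simp: dist_commute)
    have "ball d (1 / Suc n) \<subseteq> ball x e"
    proof
      fix y assume "y \<in> ball d (1 / Suc n)"
      with d(2) have "dist x y < 1 / Suc n + 1 / Suc n"
        using dist_triangle_less_add[of x d _ y] by (metis dist_commute mem_ball)
      also have "\<dots> < e" using n by (simp add: inverse_eq_divide)
      finally show "y \<in> ball x e" by simp
    qed
    with e \<open>x \<in> A\<close> have "P (d, n) x" by (auto simp: P_def)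
    with d have "(d, n) \<in> I" by (auto simp: I_def)
    with f[OF this] d(2) show "x \<in> (\<Union>x\<in>f ` I. V x)"
      by (auto simp: P_def)
  qed
  moreover have "f ` I \<subseteq> A" using f by (auto simp: P_def)
  moreover have "countable (f ` I)"
    unfolding I_def using D(1) by (intro countable_image countable_Collect) auto
  ultimately show ?thesis using that by blast
qed

text \<open>
  The two centres as they would come out of a greedy selection of balls by almost decreasing radius:
  the later centre avoids the earlier ball, and its radius is at most \<open>\<tau>\<close> times the earlier one.
\<close>

definition controlled :: "real \<Rightarrow> ('a::metric_space \<Rightarrow> real) \<Rightarrow> 'a \<Rightarrow> 'a \<Rightarrow> bool" where
  "controlled \<tau> R a b \<longleftrightarrow>
    R a < dist a b \<and> R b \<le> \<tau> * R a \<or> R b < dist a b \<and> R a \<le> \<tau> * R b"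

lemma controlled_sym: "controlled \<tau> R a b \<longleftrightarrow> controlled \<tau> R b a"
  by (auto simp: controlled_def dist_commute)

text \<open>Greedy selection of balls by decreasing radius, carried out with Zorn's lemma. A largest
  remaining radius need not exist; \<open>M\<close> makes the supremum finite, and
  \<open>\<tau> > 1\<close> leaves room to pick a radius close to it.\<close>

lemma controlled_selection:
  fixes R :: "'a::metric_space \<Rightarrow> real"
  assumes R: "\<And>a. a \<in> A \<Longrightarrow> 0 < R a \<and> R a \<le> M" and \<tau>: "1 < \<tau>"
  obtains S where "S \<subseteq> A" "pairwise (controlled \<tau> R) S" "A \<subseteq> (\<Union>s\<in>S. cball s (R s))"
proof -
  define cov where "cov S = (\<Union>s\<in>S. cball s (R s))" for S
  \<comment> \<open>The last clause makes a maximal element a cover: an uncovered point of almost maximal radius could be added.\<close>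
  define \<Omega> where "\<Omega> = {S. S \<subseteq> A \<and> pairwise (controlled \<tau> R) S \<and>
    (\<forall>a\<in>A. (\<exists>s\<in>S. s \<noteq> a \<and> \<not> controlled \<tau> R s a) \<longrightarrow> a \<in> cov S)}"
  have "\<exists>S\<in>\<Omega>. \<forall>X\<in>\<Omega>. S \<subseteq> X \<longrightarrow> X = S"
  proof (rule subset_Zorn_nonempty)
    show "\<Omega> \<noteq> {}" by (auto simp: \<Omega>_def intro!: exI[of _ "{}"])
  next
    fix \<C> assume ne: "\<C> \<noteq> {}" and ch: "subset.chain \<Omega> \<C>"
    have sub: "\<And>S. S \<in> \<C> \<Longrightarrow> S \<in> \<Omega>" and tot: "\<And>S T. S \<in> \<C> \<Longrightarrow> T \<in> \<C> \<Longrightarrow> S \<subseteq> T \<or> T \<subseteq> S"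
      using ch by (auto simp: subset_chain_def)
    have "pairwise (controlled \<tau> R) (\<Union>\<C>)"
    proof (rule pairwiseI)
      fix a b assume "a \<in> \<Union>\<C>" "b \<in> \<Union>\<C>" "a \<noteq> b"
      then obtain S where "S \<in> \<C>" "a \<in> S" "b \<in> S" using tot by blast
      then show "controlled \<tau> R a b"
        using sub[of S] \<open>a \<noteq> b\<close> by (auto simp: \<Omega>_def pairwise_def)
    qed
    moreover have "a \<in> cov (\<Union>\<C>)"
      if "a \<in> A" "s \<in> \<Union>\<C>" "s \<noteq> a" "\<not> controlled \<tau> R s a" for a s
    proof -
      obtain S where "S \<in> \<C>" "s \<in> S" using \<open>s \<in> \<Union>\<C>\<close> by blast
      then have "a \<in> cov S" using sub[of S] that by (auto simp: \<Omega>_def)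
      then show ?thesis using \<open>S \<in> \<C>\<close> by (auto simp: cov_def)
    qed
    ultimately show "\<Union>\<C> \<in> \<Omega>" using sub by (fastforce simp: \<Omega>_def)
  qed
  then obtain S where S: "S \<in> \<Omega>" and max: "\<And>X. X \<in> \<Omega> \<Longrightarrow> S \<subseteq> X \<Longrightarrow> X = S" by blast
  have "A \<subseteq> cov S"
  proof (rule ccontr)
    define L where "L = A - cov S"
    assume "\<not> A \<subseteq> cov S"
    then have ne: "L \<noteq> {}" by (auto simp: L_def)
    have LA: "L \<subseteq> A" by (auto simp: L_def)
    define m where "m = Sup (R ` L)"
    have bdd: "bdd_above (R ` L)" using R LA by (auto intro!: bdd_aboveI[of _ M])
    have le: "R b \<le> m" if "b \<in> L" for b
      unfolding m_def using that bdd by (auto intro: cSup_upper)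
    have "0 < m" using le ne R LA by (force simp: subset_eq)
    then have "m / \<tau> < m" using \<tau> by (simp add: field_simps)
    then obtain a where a: "a \<in> L" "m / \<tau> < R a"
      using less_cSup_iff[of "R ` L" "m / \<tau>"] ne bdd by (auto simp: m_def)
    then have aA: "a \<in> A" "a \<notin> cov S" by (auto simp: L_def)
    have "insert a S \<in> \<Omega>"
    proof -
      have "controlled \<tau> R s a" if "s \<in> S" "s \<noteq> a" for s
        using S that aA by (auto simp: \<Omega>_def)
      then have "pairwise (controlled \<tau> R) (insert a S)"
        using S controlled_sym by (auto simp: \<Omega>_def pairwise_insert; blast)
      moreover have "b \<in> cov (insert a S)"
        if "b \<in> A" "s \<in> insert a S" "s \<noteq> b" "\<not> controlled \<tau> R s b" for b s
      proof (cases "b \<in> cov S")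
        case False
        \<comment> \<open>The clause for \<open>S\<close> rules out a violating partner of an
          uncovered \<open>b\<close> inside \<open>S\<close>, so only the new centre can violate
          control. As its radius is almost maximal, the violation can only mean that
          \<open>b\<close> lies in its ball.\<close>
        then have "s = a" using S that by (auto simp: \<Omega>_def)
        moreover have "R b \<le> \<tau> * R a"
          using le[of b] a(2) False that \<tau> by (simp add: L_def field_simps)
        ultimately have "dist a b \<le> R a" using that by (auto simp: controlled_def)
        then show ?thesis by (auto simp: cov_def)
      qed (auto simp: cov_def)
      ultimately show ?thesis using S aA by (auto simp: \<Omega>_def)
    qed
    then have "a \<in> S" using max by blast
    then show False using aA R by (force simp: cov_def)
  qed
  then show ?thesis using S that by (auto simp: \<Omega>_def cov_def)
qed

text \<open>Two controlled centres are further apart than the smaller of their radii. Centres of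
  radius at least \<open>1 / Suc n\<close> are thus uniformly separated, and in a separable space
  such a set is countable.\<close>

lemma countable_controlled:
  fixes R :: "'a::metric_space \<Rightarrow> real"
  assumes sep: "separable_space (euclidean :: 'a topology)"
    and R: "\<And>a. a \<in> S \<Longrightarrow> 0 < R a"
    and S: "pairwise (controlled \<tau> R) S"
  shows "countable S"
proof -
  have "countable {a\<in>S. 1 / Suc n \<le> R a}" (is "countable ?T") for n
  proof -
    obtain T where T: "T \<subseteq> ?T" "countable T" "?T \<subseteq> (\<Union>x\<in>T. ball x (1 / Suc n))"
      by (rule separable_countable_subcover[OF sep, of ?T "\<lambda>x. ball x (1 / Suc n)"]) auto
    have "?T \<subseteq> T"
    proof
      fix a assume a: "a \<in> ?T"
      with T obtain b where b: "b \<in> T" "dist b a < 1 / Suc n" by force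
      have "a = b"
      proof (rule ccontr)
        assume "a \<noteq> b"
        then have "controlled \<tau> R a b" using S a b T(1) by (auto simp: pairwise_def)
        then show False using a b T(1) by (force simp: controlled_def dist_commute)
      qed
      with b show "a \<in> T" by simp
    qed
    with T(2) show ?thesis by (rule countable_subset[rotated])
  qed
  then have "countable (\<Union>n. {a\<in>S. 1 / Suc n \<le> R a})" by blast
  moreover have "S \<subseteq> (\<Union>n. {a\<in>S. 1 / Suc n \<le> R a})"
  proof
    fix a assume "a \<in> S"
    with R[of a] obtain n where "inverse (Suc n) < R a" using reals_Archimedean by blast
    with \<open>a \<in> S\<close> show "a \<in> (\<Union>n. {a\<in>S. 1 / Suc n \<le> R a})"
      by (auto simp: inverse_eq_divide intro!: exI[of _ n])
  qed
  ultimately show ?thesis by (rule countable_subset[rotated])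
qed

section \<open>Bounded overlap and colouring of controlled families\<close>

text \<open>Here \<open>a\<close> has the smallest radius and \<open>T\<close> consists of centres
  whose balls may meet its ball. Directional limitedness at \<open>a\<close> is used twice, for
  centres near to \<open>a\<close> and for those far from it, whence the factor 2.\<close>

lemma card_neighbours_le:
  fixes R :: "'a::metric_space \<Rightarrow> real"
  assumes dl: "directionally_limited_at \<xi> \<eta> \<zeta> (UNIV :: 'a set)" and \<eta>: "\<eta> \<le> 1/3"
    and a: "0 < R a" "R a < \<xi> / 2" and \<tau>: "\<tau> \<le> 16/15"
    and T: "\<And>b. b \<in> T \<Longrightarrow> controlled \<tau> R a b \<and> R a \<le> R b \<and> R b < \<xi> / 2 \<and> dist a b \<le> R a + R b"
    and pw: "pairwise (controlled \<tau> R) T"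
  shows "finite T \<and> card T \<le> 2 * \<zeta>"
proof -
  have pos: "R a < dist a b" if "b \<in> T" for b
    using T[OF that] by (auto simp: controlled_def)
  \<comment> \<open>Since \<open>\<eta>\<close> is at most \<open>1/3\<close>, it suffices to bound
    \<open>dist x c\<close> below by a third of \<open>dist a c\<close>. The radii below
    \<open>\<xi> / 2\<close> place \<open>B\<close> inside \<open>ball a \<xi>\<close>.\<close>
  have lim: "finite B \<and> card B \<le> \<zeta>"
    if "B \<subseteq> T" and dir: "\<And>b c x. \<lbrakk>b \<in> B; c \<in> B; b \<noteq> c; dist a c \<le> dist a b; dist a x = dist a c;
      dist a x + dist x b = dist a b\<rbrakk> \<Longrightarrow> dist a c / 3 \<le> dist x c" for B
  proof -
    have 1: "B \<subseteq> UNIV \<inter> (ball a \<xi> - {a})"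
    proof
      fix b assume "b \<in> B"
      with that T[of b] pos[of b] a show "b \<in> UNIV \<inter> (ball a \<xi> - {a})" by auto
    qed
    have 2: "\<eta> \<le> dist x c / dist a c"
      if "b \<in> B" "c \<in> B" "b \<noteq> c" "dist a c \<le> dist a b" "dist a x = dist a c"
        "dist a x + dist x b = dist a b" for b c x
    proof -
      have "0 < dist a c" using pos[of c] a that \<open>B \<subseteq> T\<close> by auto
      moreover have "\<eta> * dist a c \<le> 1/3 * dist a c" using \<eta> by (intro mult_right_mono) auto
      then have "\<eta> * dist a c \<le> dist x c" using dir[OF that] by linarith
      ultimately show ?thesis by (simp add: le_divide_eq)
    qed
    show ?thesis
      using dl 1 2 unfolding directionally_limited_at_def by (meson UNIV_I)
  qed
  \<comment> \<open>Near centres have mutual distance at least \<open>R a\<close>, which beats the difference of their distances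
    to \<open>a\<close>. For far centres \<open>dist b c\<close> is nearly \<open>R b\<close>, hence nearly \<open>dist a b - R a\<close>.\<close>
  define N where "N = {b\<in>T. dist a b \<le> 5/3 * R a}"
  define F where "F = {b\<in>T. 5/3 * R a < dist a b}"
  have "finite N \<and> card N \<le> \<zeta>"
  proof (rule lim)
    fix b c x assume *: "b \<in> N" "c \<in> N" "b \<noteq> c" "dist a c \<le> dist a b" "dist a x = dist a c"
      "dist a x + dist x b = dist a b"
    have "controlled \<tau> R b c" using pw * by (auto simp: pairwise_def N_def)
    then have "R a \<le> dist b c" using T[of b] T[of c] * by (auto simp: controlled_def N_def)
    \<comment> \<open>From \<open>dist x b = dist a b - dist a c\<close> one gets \<open>dist x c >=
      dist b c - dist x b >= R a - 5/3 * R a + dist a c\<close>, and \<open>R a < dist a c\<close>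
      leaves one third of \<open>dist a c\<close>.\<close>
    then show "dist a c / 3 \<le> dist x c"
      using * pos[of c] dist_triangle[of b c x] by (simp add: N_def dist_commute)
  qed (auto simp: N_def)
  moreover have "finite F \<and> card F \<le> \<zeta>"
  proof (rule lim)
    fix b c x assume *: "b \<in> F" "c \<in> F" "b \<noteq> c" "dist a c \<le> dist a b" "dist a x = dist a c"
      "dist a x + dist x b = dist a b"
    have bT: "b \<in> T" and cT: "c \<in> T" using * by (auto simp: F_def)
    have "controlled \<tau> R b c" using pw * by (auto simp: pairwise_def F_def)
    have "\<tau> * R a \<le> 16/15 * R a" and "\<tau> * R c \<le> 16/15 * R c"
      using \<tau> a T[OF cT] by (auto intro!: mult_right_mono)
    moreover have "R c \<le> dist a c"
      using T[OF cT] * \<open>\<tau> * R a \<le> 16/15 * R a\<close> by (auto simp: controlled_def F_def)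
    \<comment> \<open>Either \<open>R b < dist b c\<close>, or \<open>R c < dist b c\<close> with
      \<open>R b\<close> at most \<open>16/15 * R c\<close>. In the second case the loss is at most
      \<open>R c / 15\<close>, and \<open>R c\<close> does not exceed
      \<open>dist a c\<close>.\<close>
    ultimately have "R b - dist a c / 15 \<le> dist b c"
      using \<open>controlled \<tau> R b c\<close> zero_le_dist[of a c] unfolding controlled_def by linarith
    moreover have "dist b c \<le> dist x b + dist x c"
      using dist_triangle[of b c x] by (simp add: dist_commute)
    moreover have "5/3 * R a < dist a c" "dist a b \<le> R a + R b" using * T[OF bT] by (auto simp: F_def)
    \<comment> \<open>The estimates combine to \<open>dist x c >= 14/15 * dist a c - R a\<close>.
      Since \<open>R a < 3/5 * dist a c\<close>, exactly one third remains: the constants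
      \<open>16/15\<close> and \<open>5/3\<close> are balanced for this.\<close>
    ultimately show "dist a c / 3 \<le> dist x c" using *(5,6) by argo
  qed (auto simp: F_def)
  moreover have "T = N \<union> F" by (auto simp: N_def F_def)
  ultimately show ?thesis using card_Un_le[of N F] by auto
qed

definition ball_colouring :: "('a::metric_space \<Rightarrow> real) \<Rightarrow> nat \<Rightarrow> 'a set \<Rightarrow> ('a \<Rightarrow> nat) \<Rightarrow> bool" where
  "ball_colouring R N F col \<longleftrightarrow> (\<forall>a\<in>F. col a < N) \<and>
    (\<forall>a\<in>F. \<forall>b\<in>F. a \<noteq> b \<longrightarrow> col a = col b \<longrightarrow> cball a (R a) \<inter> cball b (R b) = {})"

text \<open>Induction that takes out a ball of least radius: it meets at most
  \<open>2 * \<zeta>\<close> of the others, so one of the \<open>2 * \<zeta> + 1\<close> colours is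
  free for it.\<close>

lemma ex_ball_colouring:
  fixes R :: "'a::metric_space \<Rightarrow> real"
  assumes dl: "directionally_limited_at \<xi> \<eta> \<zeta> (UNIV :: 'a set)" and \<eta>: "\<eta> \<le> 1/3"
    and \<tau>: "\<tau> \<le> 16/15" and "finite F"
    and R: "\<And>a. a \<in> F \<Longrightarrow> 0 < R a \<and> R a < \<xi> / 2"
    and pw: "pairwise (controlled \<tau> R) F"
  shows "\<exists>col. ball_colouring R (2 * \<zeta> + 1) F col"
  using \<open>finite F\<close> R pw
proof (induction F rule: finite_remove_induct)
  case empty
  then show ?case by (auto simp: ball_colouring_def)
next
  case (remove F)
  obtain a where a: "a \<in> F" and amin: "\<And>b. b \<in> F \<Longrightarrow> R a \<le> R b"
    using arg_min_if_finite[OF remove.hyps(1,2), of R] by (metis not_le)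
  obtain col where col: "ball_colouring R (2 * \<zeta> + 1) (F - {a}) col"
    using remove.IH[OF a] remove.prems by (meson DiffD1 Diff_subset pairwise_subset)
  define T where "T = {b \<in> F - {a}. cball a (R a) \<inter> cball b (R b) \<noteq> {}}"
  have "finite T \<and> card T \<le> 2 * \<zeta>"
  proof (rule card_neighbours_le[OF dl \<eta> _ _ \<tau>])
    show "0 < R a" "R a < \<xi> / 2" using remove.prems(1) a by auto
    show "pairwise (controlled \<tau> R) T"
      using remove.prems(2) by (rule pairwise_subset) (auto simp: T_def)
    fix b assume b: "b \<in> T"
    then obtain y where "dist a y \<le> R a" "dist b y \<le> R b" by (auto simp: T_def)
    then have "dist a b \<le> R a + R b" by (metis add_mono dist_commute dist_triangle order_trans)
    then show "controlled \<tau> R a b \<and> R a \<le> R b \<and> R b < \<xi> / 2 \<and> dist a b \<le> R a + R b"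
      using b a amin remove.prems by (auto simp: T_def pairwise_def)
  qed
  then have "card (col ` T) < card {..<2 * \<zeta> + 1}"
    using card_image_le[of T col] by simp
  then obtain k where k: "k < 2 * \<zeta> + 1" "k \<notin> col ` T"
    by (metis card_mono finite_imageI \<open>finite T \<and> card T \<le> 2 * \<zeta>\<close> lessThan_iff not_le subsetI)
  have "ball_colouring R (2 * \<zeta> + 1) F (col(a := k))"
    unfolding ball_colouring_def
  proof (intro conjI ballI impI)
    fix b c assume bc: "b \<in> F" "c \<in> F" "b \<noteq> c" "(col(a := k)) b = (col(a := k)) c"
    consider "b = a" | "c = a" | "b \<noteq> a" "c \<noteq> a" by blast
    then show "cball b (R b) \<inter> cball c (R c) = {}"
    proof cases
      case 1
      then have "c \<notin> T" using bc k by auto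
      then show ?thesis using 1 bc by (auto simp: T_def)
    next
      case 2
      then have "b \<notin> T" using bc k by auto
      then show ?thesis using 2 bc by (auto simp: T_def)
    next
      case 3
      then show ?thesis using col bc by (auto simp: ball_colouring_def)
    qed
  qed (use k col in \<open>auto simp: ball_colouring_def\<close>)
  then show ?case by blast
qed

text \<open>The colouring is asserted for finite subfamilies because its construction starts from a
  ball of least radius. Continuity of measures from below later passes to the countable
  cover.\<close>

lemma besicovitch_covering:
  fixes R :: "'a::metric_space \<Rightarrow> real"
  assumes sep: "separable_space (euclidean :: 'a topology)"
    and dl: "directionally_limited_at \<xi> \<eta> \<zeta> (UNIV :: 'a set)" "\<eta> \<le> 1/3"
    and R: "\<And>a. a \<in> A \<Longrightarrow> 0 < R a \<and> R a < \<xi> / 2"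
  obtains S where "S \<subseteq> A" "countable S" "A \<subseteq> (\<Union>s\<in>S. cball s (R s))"
    "\<And>F. finite F \<Longrightarrow> F \<subseteq> S \<Longrightarrow> \<exists>col. ball_colouring R (2 * \<zeta> + 1) F col"
proof -
  obtain S where S: "S \<subseteq> A" "pairwise (controlled (16/15) R) S" "A \<subseteq> (\<Union>s\<in>S. cball s (R s))"
    by (rule controlled_selection[of A R "\<xi> / 2" "16/15"]) (use R in force)+
  have "countable S"
    using S R by (intro countable_controlled[OF sep _ S(2)]) auto
  moreover have "\<exists>col. ball_colouring R (2 * \<zeta> + 1) F col" if "finite F" "F \<subseteq> S" for F
    using that S R
    by (intro ex_ball_colouring[OF dl order.refl]) (auto intro: pairwise_subset)
  ultimately show ?thesis using S that by blast
qed

subsection \<open>Null sets and the Vitali covering theorem\<close>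

lemma emeasure_countable_UN_le:
  assumes S: "countable S" and A: "\<And>s. s \<in> S \<Longrightarrow> A s \<in> sets M"
    and le: "\<And>F. finite F \<Longrightarrow> F \<subseteq> S \<Longrightarrow> emeasure M (\<Union>s\<in>F. A s) \<le> c"
  shows "emeasure M (\<Union>s\<in>S. A s) \<le> c"
proof (cases "S = {}")
  case False
  define f where "f = from_nat_into S"
  have f: "range f = S" using S False by (simp add: f_def range_from_nat_into)
  have "(\<Union>s\<in>S. A s) = (\<Union>n. \<Union>s\<in>f ` {..<n}. A s)"
    unfolding f[symmetric] by auto
  also have "emeasure M \<dots> = (SUP n. emeasure M (\<Union>s\<in>f ` {..<n}. A s))"
  proof (rule SUP_emeasure_incseq[symmetric])
    show "range (\<lambda>n. \<Union>s\<in>f ` {..<n}. A s) \<subseteq> sets M"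
      using A f by (auto intro!: sets.finite_UN)
    show "incseq (\<lambda>n. \<Union>s\<in>f ` {..<n}. A s)"
      by (rule monoI) force
  qed
  also have "\<dots> \<le> c" using f by (intro SUP_least le) auto
  finally show ?thesis .
qed (use le[of "{}"] in auto)

section \<open>Measures of coloured families of balls\<close>

lemma ball_colouring_sum_le:
  fixes M :: "'a::metric_space measure"
  assumes col: "ball_colouring R N F col" and "finite F" and M: "sets M = sets borel"
    and W: "W \<in> sets M" and sub: "\<And>a. a \<in> F \<Longrightarrow> cball a (R a) \<subseteq> W"
  shows "(\<Sum>a\<in>F. emeasure M (cball a (R a))) \<le> of_nat N * emeasure M W"
proof -
  have "(\<Sum>a\<in>F. emeasure M (cball a (R a)))
      = (\<Sum>k<N. \<Sum>a\<in>{a\<in>F. col a = k}. emeasure M (cball a (R a)))"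
    using \<open>finite F\<close> col by (intro sum.group[symmetric]) (auto simp: ball_colouring_def)
  also have "\<dots> \<le> (\<Sum>k<N. emeasure M W)"
  proof (rule sum_mono)
    fix k
    have "(\<Sum>a\<in>{a\<in>F. col a = k}. emeasure M (cball a (R a)))
        = emeasure M (\<Union>a\<in>{a\<in>F. col a = k}. cball a (R a))"
      using \<open>finite F\<close> M col
      by (intro sum_emeasure) (auto simp: disjoint_family_on_def ball_colouring_def)
    also have "\<dots> \<le> emeasure M W" using W sub by (intro emeasure_mono) auto
    finally show "(\<Sum>a\<in>{a\<in>F. col a = k}. emeasure M (cball a (R a))) \<le> emeasure M W" .
  qed
  finally show ?thesis by simp
qed

text \<open>Pigeonhole: by sub-additivity over the \<open>N\<close> colour classes, the one of
  largest measure carries at least the \<open>N\<close>-th part of the total.\<close>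

lemma ball_colouring_heavy_class:
  fixes M :: "'a::metric_space measure"
  assumes col: "ball_colouring R N F col" and "finite F" and M: "sets M = sets borel"
    and "0 < N"
  obtains G where "G \<subseteq> F" "disjoint_family_on (\<lambda>a. cball a (R a)) G"
    "emeasure M (\<Union>a\<in>F. cball a (R a)) \<le> of_nat N * emeasure M (\<Union>a\<in>G. cball a (R a))"
proof -
  define G where "G k = {a\<in>F. col a = k}" for k
  define f where "f k = emeasure M (\<Union>a\<in>G k. cball a (R a))" for k
  have "Max (f ` {..<N}) \<in> f ` {..<N}" using \<open>0 < N\<close> by (intro Max_in) auto
  then obtain k where k: "k < N" "f k = Max (f ` {..<N})" by auto
  have "(\<Union>a\<in>F. cball a (R a)) = (\<Union>j<N. \<Union>a\<in>G j. cball a (R a))"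
    using col by (auto simp: G_def ball_colouring_def)
  then have "emeasure M (\<Union>a\<in>F. cball a (R a)) \<le> (\<Sum>j<N. f j)"
    using \<open>finite F\<close> M unfolding f_def
    by (auto intro!: emeasure_subadditive_finite sets.finite_UN simp: G_def)
  also have "\<dots> \<le> (\<Sum>j<N. f k)" using k by (intro sum_mono) auto
  finally have "emeasure M (\<Union>a\<in>F. cball a (R a)) \<le> of_nat N * f k" by simp
  moreover have "disjoint_family_on (\<lambda>a. cball a (R a)) (G k)"
    using col by (auto simp: disjoint_family_on_def ball_colouring_def G_def)
  ultimately show ?thesis using that[of "G k"] by (auto simp: f_def G_def)
qed

text \<open>Cover \<open>Z\<close> by balls inside \<open>W\<close> on which \<open>M\<close> is at
  most \<open>\<epsilon>' * N\<close>. Each of the \<open>2 * \<zeta> + 1\<close> colour classes is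
  disjoint, so the cover has \<open>M\<close>-measure at most \<open>\<epsilon>'\<close> times a
  multiple of the finite \<open>N\<close>-measure of \<open>W\<close>. As \<open>Z\<close> may fail
  to be measurable, the result is a null superset.\<close>

lemma null_if_small_balls:
  fixes M N :: "'a::metric_space measure"
  assumes sep: "separable_space (euclidean :: 'a topology)"
    and dl: "directionally_limited_at \<xi> \<eta> \<zeta> (UNIV :: 'a set)" "\<eta> \<le> 1/3" "0 < \<xi>"
    and M: "sets M = sets borel" and N: "sets N = sets borel"
    and W: "open W" "emeasure N W < \<infinity>" "Z \<subseteq> W"
    and small: "\<And>x \<epsilon> \<delta>. x \<in> Z \<Longrightarrow> 0 < \<epsilon> \<Longrightarrow> 0 < \<delta> \<Longrightarrow>
      \<exists>r. 0 < r \<and> r < \<delta> \<and> emeasure M (cball x r) \<le> ennreal \<epsilon> * emeasure N (cball x r)"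
  shows "\<exists>Y\<in>null_sets M. Z \<subseteq> Y"
proof -
  have approx: "\<exists>Y\<in>sets M. Z \<subseteq> Y \<and> emeasure M Y \<le> ennreal \<epsilon>" if "0 < \<epsilon>" for \<epsilon>
  proof -
    define c where "c = (2 * real \<zeta> + 1) * measure N W"
    \<comment> \<open>The \<open>+ 1\<close> keeps the denominator positive when \<open>W\<close>
      has \<open>N\<close>-measure zero.\<close>
    define \<epsilon>' where "\<epsilon>' = \<epsilon> / (c + 1)"
    have c: "0 \<le> c" by (simp add: c_def)
    have \<epsilon>': "0 < \<epsilon>'" unfolding \<epsilon>'_def using \<open>0 < \<epsilon>\<close> c by (intro divide_pos_pos) linarith+
    have "\<epsilon>' * c \<le> \<epsilon>' * (c + 1)" using \<epsilon>' by (intro mult_left_mono) auto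
    also have "\<dots> = \<epsilon>" using c by (simp add: \<epsilon>'_def)
    finally have \<epsilon>'c: "\<epsilon>' * c \<le> \<epsilon>" .
    have "\<exists>r. 0 < r \<and> r < \<xi> / 2 \<and> cball x r \<subseteq> W \<and>
        emeasure M (cball x r) \<le> ennreal \<epsilon>' * emeasure N (cball x r)" if x: "x \<in> Z" for x
    proof -
      obtain e where e: "0 < e" "cball x e \<subseteq> W"
        using W(1,3) x by (metis open_contains_cball subsetD)
      then have "0 < min e (\<xi> / 2)" using dl by simp
      from small[OF x \<epsilon>' this] obtain r where r: "0 < r" "r < min e (\<xi> / 2)"
        "emeasure M (cball x r) \<le> ennreal \<epsilon>' * emeasure N (cball x r)" by blast
      then have "cball x r \<subseteq> W" using e by (auto simp: subset_eq)
      with r show ?thesis by auto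
    qed
    then obtain R where R: "\<And>x. x \<in> Z \<Longrightarrow> 0 < R x \<and> R x < \<xi> / 2 \<and> cball x (R x) \<subseteq> W \<and>
        emeasure M (cball x (R x)) \<le> ennreal \<epsilon>' * emeasure N (cball x (R x))"
      by metis
    obtain S where S: "S \<subseteq> Z" "countable S" "Z \<subseteq> (\<Union>s\<in>S. cball s (R s))"
      and col: "\<And>F. finite F \<Longrightarrow> F \<subseteq> S \<Longrightarrow> \<exists>col. ball_colouring R (2 * \<zeta> + 1) F col"
      using besicovitch_covering[OF sep dl(1,2), of Z R] R by blast
    have "emeasure M (\<Union>s\<in>S. cball s (R s)) \<le> ennreal \<epsilon>"
    proof (rule emeasure_countable_UN_le[OF S(2)])
      fix F assume F: "finite F" "F \<subseteq> S"
      then obtain col where col: "ball_colouring R (2 * \<zeta> + 1) F col" using col by blast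
      have "emeasure M (\<Union>s\<in>F. cball s (R s)) \<le> (\<Sum>s\<in>F. emeasure M (cball s (R s)))"
        using F M by (intro emeasure_subadditive_finite) auto
      also have "\<dots> \<le> (\<Sum>s\<in>F. ennreal \<epsilon>' * emeasure N (cball s (R s)))"
        using R F S by (intro sum_mono) auto
      also have "\<dots> = ennreal \<epsilon>' * (\<Sum>s\<in>F. emeasure N (cball s (R s)))"
        by (simp add: sum_distrib_left)
      also have "\<dots> \<le> ennreal \<epsilon>' * (of_nat (2 * \<zeta> + 1) * emeasure N W)"
        using R F S W N by (intro mult_left_mono ball_colouring_sum_le[OF col]) auto
      also have "\<dots> = ennreal (\<epsilon>' * c)"
      proof -
        have "emeasure N W = ennreal (measure N W)"
          using W by (intro emeasure_eq_ennreal_measure) auto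
        moreover have "of_nat (2 * \<zeta> + 1) = ennreal (2 * real \<zeta> + 1)"
          unfolding ennreal_of_nat_eq_real_of_nat by (simp add: add.commute)
        ultimately show ?thesis using \<epsilon>' by (simp add: c_def ennreal_mult add.commute)
      qed
      also have "\<dots> \<le> ennreal \<epsilon>" using \<epsilon>'c by (rule ennreal_leI)
      finally show "emeasure M (\<Union>s\<in>F. cball s (R s)) \<le> ennreal \<epsilon>" .
    qed (simp add: M)
    moreover have "(\<Union>s\<in>S. cball s (R s)) \<in> sets M"
      by (intro sets.countable_UN'[OF S(2)]) (simp add: M image_subset_iff)
    ultimately show ?thesis using S(3) by blast
  qed
  have "\<exists>Y\<in>sets M. Z \<subseteq> Y \<and> emeasure M Y \<le> ennreal (1 / Suc n)" for n
    by (rule approx) simp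
  then obtain Y where Y: "\<And>n. Y n \<in> sets M" "\<And>n. Z \<subseteq> Y n"
    "\<And>n. emeasure M (Y n) \<le> ennreal (1 / Suc n)" by metis
  have "emeasure M (\<Inter>n. Y n) \<le> 0"
  proof (rule ennreal_le_epsilon)
    fix e :: real assume "0 < e"
    then obtain n where n: "inverse (Suc n) < e" using reals_Archimedean by blast
    have "emeasure M (\<Inter>n. Y n) \<le> emeasure M (Y n)" using Y by (intro emeasure_mono) auto
    also have "\<dots> \<le> ennreal (1 / Suc n)" by (rule Y)
    also have "\<dots> \<le> ennreal e" using n by (intro ennreal_leI) (simp add: inverse_eq_divide)
    finally show "emeasure M (\<Inter>n. Y n) \<le> 0 + ennreal e" by simp
  qed
  moreover have "(\<Inter>n. Y n) \<in> sets M" using Y by auto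
  ultimately show ?thesis using Y(2) by (intro bexI[of _ "\<Inter>n. Y n"]) auto
qed

section \<open>Exhaustion of open sets by finite disjoint families of balls\<close>

text \<open>Finiteness makes the union closed, so that removing it from an open set leaves an open
  set in which the selection can be repeated.\<close>

definition ball_packing :: "('a::metric_space set \<Rightarrow> bool) \<Rightarrow> 'a set \<Rightarrow> 'a set set \<Rightarrow> bool" where
  "ball_packing P W G \<longleftrightarrow> finite G \<and> disjoint G \<and> \<Union>G \<subseteq> W \<and>
    (\<forall>B\<in>G. P B \<and> (\<exists>x r. 0 < r \<and> B = cball x r))"

lemma ball_packing_closed: "ball_packing P W G \<Longrightarrow> B \<in> G \<Longrightarrow> closed B"
  by (auto simp: ball_packing_def)

text \<open>One round of the exhaustion. A finite part of the Besicovitch cover of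
  \<open>W - Z\<close> has more than half of the measure of \<open>W\<close>, and its heaviest
  colour class is a disjoint family with at least a fixed fraction of that.\<close>

lemma vitali_step:
  fixes M :: "'a::metric_space measure"
  assumes sep: "separable_space (euclidean :: 'a topology)"
    and dl: "directionally_limited_at \<xi> \<eta> \<zeta> (UNIV :: 'a set)" "\<eta> \<le> 1/3" "0 < \<xi>"
    and M: "sets M = sets borel"
    and W: "open W" "emeasure M W < \<infinity>" "0 < emeasure M W" and Z: "Z \<in> null_sets M"
    and fine: "\<And>x \<delta>. x \<in> W - Z \<Longrightarrow> 0 < \<delta> \<Longrightarrow> \<exists>r. 0 < r \<and> r < \<delta> \<and> P (cball x r)"
  obtains G where "ball_packing P W G" "measure M W / 2 < (2 * real \<zeta> + 1) * measure M (\<Union>G)"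
proof -
  have Wset: "W \<in> sets M" using W M by auto
  have "\<exists>r. 0 < r \<and> r < \<xi> / 2 \<and> cball x r \<subseteq> W \<and> P (cball x r)" if x: "x \<in> W - Z" for x
  proof -
    obtain e where e: "0 < e" "cball x e \<subseteq> W"
      using W x open_contains_cball by (metis DiffD1)
    then have "0 < min e (\<xi> / 2)" using dl by simp
    from fine[OF x this] obtain r where r: "0 < r" "r < min e (\<xi> / 2)" "P (cball x r)" by blast
    then have "cball x r \<subseteq> W" using e by (auto simp: subset_eq)
    with r show ?thesis by auto
  qed
  then obtain R where R: "\<And>x. x \<in> W - Z \<Longrightarrow>
      0 < R x \<and> R x < \<xi> / 2 \<and> cball x (R x) \<subseteq> W \<and> P (cball x (R x))"
    by metis
  obtain S where S: "S \<subseteq> W - Z" "countable S" "W - Z \<subseteq> (\<Union>s\<in>S. cball s (R s))"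
    and col: "\<And>F. finite F \<Longrightarrow> F \<subseteq> S \<Longrightarrow> \<exists>col. ball_colouring R (2 * \<zeta> + 1) F col"
    using besicovitch_covering[OF sep dl(1,2), of "W - Z" R] R by blast
  have fin: "emeasure M W = ennreal (measure M W)"
    using W by (intro emeasure_eq_ennreal_measure) auto
  have "0 < measure M W" using W(3) fin by (metis ennreal_less_zero_iff)
  have "emeasure M W = emeasure M (W - Z)"
    using Z Wset by (simp add: emeasure_Diff_null_set)
  also have "\<dots> \<le> emeasure M (\<Union>s\<in>S. cball s (R s))"
    using S M by (intro emeasure_mono) (auto intro!: sets.countable_UN')
  finally have "ennreal (measure M W / 2) < emeasure M (\<Union>s\<in>S. cball s (R s))"
    using fin \<open>0 < measure M W\<close> by (auto intro: less_le_trans[rotated] simp: ennreal_less_iff)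
  then obtain F where F: "finite F" "F \<subseteq> S"
    and big: "ennreal (measure M W / 2) < emeasure M (\<Union>s\<in>F. cball s (R s))"
    using emeasure_countable_UN_le[OF S(2), of "\<lambda>s. cball s (R s)" M "ennreal (measure M W / 2)"] M
    by (force simp: not_le[symmetric])
  obtain col where col: "ball_colouring R (2 * \<zeta> + 1) F col" using F col by blast
  obtain G where G: "G \<subseteq> F" "disjoint_family_on (\<lambda>a. cball a (R a)) G"
    "emeasure M (\<Union>a\<in>F. cball a (R a)) \<le> of_nat (2 * \<zeta> + 1) * emeasure M (\<Union>a\<in>G. cball a (R a))"
    by (rule ball_colouring_heavy_class[OF col F(1) M]) auto
  let ?G = "(\<lambda>a. cball a (R a)) ` G"
  have GW: "\<Union>?G \<subseteq> W" using G F S R by blast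
  then have finG: "emeasure M (\<Union>?G) = ennreal (measure M (\<Union>?G))"
    using W Wset emeasure_mono[OF GW Wset] by (intro emeasure_eq_ennreal_measure) auto
  have "of_nat (2 * \<zeta> + 1) = ennreal (2 * real \<zeta> + 1)"
    unfolding ennreal_of_nat_eq_real_of_nat by (simp add: add.commute)
  then have "of_nat (2 * \<zeta> + 1) * emeasure M (\<Union>?G) = ennreal ((2 * real \<zeta> + 1) * measure M (\<Union>?G))"
    unfolding finG by (simp only: ennreal_mult[symmetric] measure_nonneg)
  then have "ennreal (measure M W / 2) < ennreal ((2 * real \<zeta> + 1) * measure M (\<Union>?G))"
    using less_le_trans[OF big G(3)] by (simp only:)
  then have "measure M W / 2 < (2 * real \<zeta> + 1) * measure M (\<Union>?G)"
    by (simp add: ennreal_less_iff)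
  moreover have "ball_packing P W ?G"
    unfolding ball_packing_def
  proof (intro conjI ballI)
    show "disjoint ?G" by (rule disjoint_family_on_disjoint_image[OF G(2)])
    show "finite ?G" using G F finite_subset by blast
    fix B assume "B \<in> ?G"
    then obtain s where s: "s \<in> G" "B = cball s (R s)" by blast
    then have "s \<in> W - Z" using G F S by blast
    with R s show "P B" "\<exists>x r. 0 < r \<and> B = cball x r" by blast+
  qed (use GW in auto)
  ultimately show ?thesis using that by blast
qed

text \<open>The fraction gained in \<open>vitali_step\<close> does not depend on the open set.
  Arguing with the supremum of the measures of all finite packings replaces an explicit iteration of
  that step.\<close>

lemma vitali_besicovitch:
  fixes M :: "'a::metric_space measure"
  assumes sep: "separable_space (euclidean :: 'a topology)"
    and dl: "directionally_limited_at \<xi> \<eta> \<zeta> (UNIV :: 'a set)" "\<eta> \<le> 1/3" "0 < \<xi>"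
    and M: "sets M = sets borel"
    and W: "open W" "emeasure M W < \<infinity>" and Z: "Z \<in> null_sets M"
    and fine: "\<And>x \<delta>. x \<in> W - Z \<Longrightarrow> 0 < \<delta> \<Longrightarrow> \<exists>r. 0 < r \<and> r < \<delta> \<and> P (cball x r)"
    and c: "c < emeasure M W"
  obtains G where "ball_packing P W G" "c < emeasure M (\<Union>G)"
proof -
  define X where "X = {measure M (\<Union>G) | G. ball_packing P W G}"
  \<comment> \<open>The extra factor 2 is the half of the measure given up in
    \<open>vitali_step\<close>.\<close>
  define K where "K = 2 * (2 * real \<zeta> + 1)"
  have "0 < K" by (simp add: K_def)
  have Wset: "W \<in> sets M" using W M by auto
  have Wfm: "W \<in> fmeasurable M" using W Wset by (intro fmeasurableI) auto
  have Gset: "\<Union>G \<in> sets M" if "ball_packing P V G" for V G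
    using that ball_packing_closed[OF that] M
    by (intro sets.finite_Union) (auto simp: ball_packing_def)
  have le: "measure M (\<Union>G) \<le> measure M W" if "ball_packing P W G" for G
    using that Gset[OF that] Wfm by (intro measure_mono_fmeasurable) (auto simp: ball_packing_def)
  have ne: "X \<noteq> {}" by (auto simp: X_def ball_packing_def intro!: exI[of _ "{}"])
  have bdd: "bdd_above X" using le by (auto simp: X_def intro!: bdd_aboveI[of _ "measure M W"])
  have "measure M W \<le> Sup X"
  proof (rule ccontr)
    define s where "s = Sup X"
    \<comment> \<open>A packing within \<open>(measure M W - s) / K\<close> of the supremum is improved beyond it by one more step on the open rest.\<close>
    assume "\<not> measure M W \<le> Sup X"
    then have s: "s < measure M W" by (simp add: s_def)
    then have "s - (measure M W - s) / K < s" using \<open>0 < K\<close> by simp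
    then have "\<exists>y\<in>X. s - (measure M W - s) / K < y"
      using less_cSup_iff[OF ne bdd] unfolding s_def by blast
    then obtain G where G: "ball_packing P W G" "s - (measure M W - s) / K < measure M (\<Union>G)"
      by (auto simp: X_def)
    define V where "V = W - \<Union>G"
    have Gs: "measure M (\<Union>G) \<le> s"
      using G(1) bdd unfolding s_def X_def by (intro cSup_upper) auto
    have GW: "\<Union>G \<subseteq> W" using G(1) by (auto simp: ball_packing_def)
    have mV: "measure M V = measure M W - measure M (\<Union>G)"
      unfolding V_def using Wfm Gset[OF G(1)] GW W(2) by (intro measure_Diff) auto
    have "emeasure M V \<le> emeasure M W"
      using Wset by (intro emeasure_mono) (auto simp: V_def)
    then have Vfin: "emeasure M V < \<infinity>" using W(2) by (rule le_less_trans)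
    have Vpos: "0 < emeasure M V"
    proof -
      have "measure M V > 0" using mV Gs s by simp
      then show ?thesis by (auto simp: measure_def zero_less_iff_neq_zero)
    qed
    have "open V"
      unfolding V_def using W(1) G(1) ball_packing_closed[OF G(1)]
      by (intro open_Diff closed_Union) (auto simp: ball_packing_def)
    then obtain H where H: "ball_packing P V H"
      "measure M V / 2 < (2 * real \<zeta> + 1) * measure M (\<Union>H)"
      by (rule vitali_step[OF sep dl M _ Vfin Vpos Z]) (use fine in \<open>auto simp: V_def\<close>)
    have dj: "\<Union>G \<inter> \<Union>H = {}" using H(1) by (auto simp: ball_packing_def V_def)
    have "disjoint (G \<union> H)"
      using G(1) H(1) dj by (intro disjoint_union) (auto simp: ball_packing_def)
    then have GH: "ball_packing P W (G \<union> H)"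
      using G(1) H(1) by (auto simp: ball_packing_def V_def)
    have fmG: "\<Union>G \<in> fmeasurable M"
      using Wfm Gset[OF G(1)] GW by (metis fmeasurableI2)
    have "\<Union>H \<subseteq> W" using GH by (auto simp: ball_packing_def)
    then have fmH: "\<Union>H \<in> fmeasurable M"
      using Wfm Gset[OF H(1)] by (metis fmeasurableI2)
    have "measure M (\<Union>(G \<union> H)) = measure M (\<Union>G) + measure M (\<Union>H)"
      using fmG fmH dj by (simp add: Union_Un_distrib measure_Un3)
    moreover have "measure M (\<Union>(G \<union> H)) \<in> X" unfolding X_def using GH by blast
    then have "measure M (\<Union>(G \<union> H)) \<le> s" using bdd unfolding s_def by (rule cSup_upper)
    moreover have "(measure M W - s) / K < measure M (\<Union>H)"
    proof -
      have "measure M W - s \<le> measure M V" using mV Gs by simp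
      also have "\<dots> < K * measure M (\<Union>H)" using H(2) by (simp add: K_def algebra_simps)
      finally show ?thesis using \<open>0 < K\<close> by (simp add: field_simps)
    qed
    ultimately show False using G(2) by simp
  qed
  have fin: "emeasure M W = ennreal (measure M W)"
    using W by (intro emeasure_eq_ennreal_measure) auto
  obtain c' where c': "c = ennreal c'" "0 \<le> c'"
    using c W(2) by (cases c) auto
  then have "c' < Sup X"
    using c fin \<open>measure M W \<le> Sup X\<close> by (simp add: ennreal_less_iff)
  then obtain G where G: "ball_packing P W G" "c' < measure M (\<Union>G)"
    using less_cSup_iff[OF ne bdd] by (auto simp: X_def)
  have "\<Union>G \<subseteq> W" using G(1) by (auto simp: ball_packing_def)
  then have "emeasure M (\<Union>G) \<le> emeasure M W" using Wset by (rule emeasure_mono)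
  then have "emeasure M (\<Union>G) = ennreal (measure M (\<Union>G))"
    using W by (intro emeasure_eq_ennreal_measure) auto
  with G c' that show ?thesis by (simp add: ennreal_less_iff)
qed

subsection \<open>The lower bound on open sets\<close>

lemma sum_le_packing_size:
  assumes "packing U \<delta> G" "finite G"
  shows "sum q G \<le> packing_size q \<delta> U"
  unfolding packing_size_def using assms
  by (intro SUP_upper2[of G]) auto

text \<open>Subfamilies of packings are packings, and a sum in \<open>ennreal\<close> is the
  supremum of its finite partial sums. Hence only finite packings have to be estimated from here
  on.\<close>

lemma packing_size_le:
  assumes "\<And>G. finite G \<Longrightarrow> packing U \<delta> G \<Longrightarrow> sum q G \<le> c"
  shows "packing_size q \<delta> U \<le> c"
  unfolding packing_size_def
proof (rule SUP_least)
  fix F assume "F \<in> {F. packing U \<delta> F}"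
  then have F: "packing U \<delta> F" by simp
  have "packing U \<delta> G" if "finite G" "G \<subseteq> F" for G
  proof -
    have "disjoint G" using F that(2) by (auto simp: packing_def intro: pairwise_subset)
    moreover have "\<Union>G \<subseteq> U" using F that(2) by (auto simp: packing_def)
    ultimately show ?thesis
      using F that by (simp add: packing_def countable_finite subset_iff)
  qed
  then show "(\<Sum>\<^sub>\<infinity>B\<in>F. q B) \<le> c"
    using assms by (subst nonneg_infsum_complete) (auto intro!: SUP_least)
qed

lemma packing_open_le_size: "0 < \<delta> \<Longrightarrow> packing_open q U \<le> packing_size q \<delta> U"
  unfolding packing_open_def by (intro INF_lower) auto

lemma packing_subset:
  "packing U \<delta> F \<Longrightarrow> U \<subseteq> V \<Longrightarrow> \<delta> \<le> \<epsilon> \<Longrightarrow> packing V \<epsilon> F"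
  unfolding packing_def by (meson dual_order.trans less_le_trans)

lemma packing_size_mono: "U \<subseteq> V \<Longrightarrow> \<delta> \<le> \<epsilon> \<Longrightarrow> packing_size q \<delta> U \<le> packing_size q \<epsilon> V"
  unfolding packing_size_def by (intro SUP_subset_mono) (auto intro: packing_subset)

lemma packing_open_mono: "U \<subseteq> V \<Longrightarrow> packing_open q U \<le> packing_open q V"
  unfolding packing_open_def by (intro INF_mono) (auto intro: packing_size_mono)

section \<open>Almost every point is the centre of balls with good radii\<close>

text \<open>At a bad point, passing from \<open>r\<close> to \<open>\<alpha> * r\<close> multiplies
  the quotient of \<open>\<mu>\<close> and \<open>\<nu>\<close> by at most \<open>h / g < 1\<close>.
  Iteration makes it arbitrarily small, so \<open>null_if_small_balls\<close> applies to the bad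
  points.\<close>

lemma good_radii:
  fixes \<mu> \<nu> :: "'a::metric_space measure"
  assumes sep: "separable_space (euclidean :: 'a topology)"
    and dl: "directionally_limited_at \<xi> \<eta> \<zeta> (UNIV :: 'a set)" "\<eta> \<le> 1/3" "0 < \<xi>"
    and \<alpha>: "0 < \<alpha>" "\<alpha> \<le> 1" and \<gamma>: "1 \<le> \<gamma>" "\<gamma> < g"
    and \<nu>: "asymptotically_bounded_measure \<alpha> \<gamma> \<nu>"
    and \<mu>: "sets \<mu> = sets borel"
    and fin: "\<And>x. x \<in> U \<Longrightarrow> \<exists>r>0. emeasure \<mu> (cball x r) < \<infinity>"
  obtains Y where "Y \<in> null_sets \<mu>"
    "\<And>x \<delta>. x \<in> U - Y \<Longrightarrow> 0 < \<delta> \<Longrightarrow> \<exists>r. 0 < r \<and> r < \<delta> \<and>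
      emeasure \<mu> (cball x r) \<le> ennreal g * emeasure \<mu> (cball x (\<alpha> * r))"
proof -
  have \<nu>set: "sets \<nu> = sets borel"
    and \<nu>fin: "\<And>A. A \<in> sets borel \<Longrightarrow> bounded A \<Longrightarrow> emeasure \<nu> A < \<infinity>"
    and \<nu>pos: "\<And>x r. 0 < r \<Longrightarrow> 0 < emeasure \<nu> (cball x r)"
    and \<nu>lim: "\<And>x. Limsup (at_right 0)
      (\<lambda>r. emeasure \<nu> (cball x r) / emeasure \<nu> (cball x (\<alpha> * r))) \<le> ennreal \<gamma>"
    using \<nu> by (auto simp: asymptotically_bounded_measure_def)
  define Z where "Z = {x\<in>U. \<exists>\<delta>>0. \<forall>r. 0 < r \<longrightarrow> r < \<delta> \<longrightarrow>
      ennreal g * emeasure \<mu> (cball x (\<alpha> * r)) < emeasure \<mu> (cball x r)}"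
  \<comment> \<open>The gap above \<open>\<gamma>\<close> turns the bound on the upper limit into an
    eventual strict inequality; the gap below \<open>g\<close> yields geometric decay.\<close>
  define h where "h = (\<gamma> + g) / 2"
  have h: "0 < h" "\<gamma> < h" "h < g" "0 < g" using \<gamma> by (auto simp: h_def)
  have small: "\<exists>r. 0 < r \<and> r < \<delta> \<and> emeasure \<mu> (cball x r) \<le> ennreal \<epsilon> * emeasure \<nu> (cball x r)"
    if x: "x \<in> Z" and pos: "0 < \<epsilon>" "0 < \<delta>" for x \<epsilon> \<delta>
  proof -
    obtain \<delta>1 where \<delta>1: "0 < \<delta>1" "\<And>r. 0 < r \<Longrightarrow> r < \<delta>1 \<Longrightarrow>
      ennreal g * emeasure \<mu> (cball x (\<alpha> * r)) < emeasure \<mu> (cball x r)"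
      using x by (auto simp: Z_def)
    obtain \<delta>2 where \<delta>2: "0 < \<delta>2" "emeasure \<mu> (cball x \<delta>2) < \<infinity>"
      using x fin by (auto simp: Z_def)
    have "ennreal \<gamma> < ennreal h" using h \<gamma> by (simp add: ennreal_less_iff)
    with \<nu>lim[of x] have "Limsup (at_right 0)
      (\<lambda>r. emeasure \<nu> (cball x r) / emeasure \<nu> (cball x (\<alpha> * r))) < ennreal h"
      by (rule le_less_trans)
    then have "\<forall>\<^sub>F r in at_right 0. emeasure \<nu> (cball x r) / emeasure \<nu> (cball x (\<alpha> * r)) < ennreal h"
      by (rule Limsup_lessD)
    then obtain \<delta>3 where \<delta>3: "0 < \<delta>3" "\<And>r. 0 < r \<Longrightarrow> r < \<delta>3 \<Longrightarrow>
      emeasure \<nu> (cball x r) / emeasure \<nu> (cball x (\<alpha> * r)) < ennreal h"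
      by (auto simp: eventually_at_right_field)
    define \<rho> where "\<rho> = Min {\<delta>, \<delta>1, \<delta>2, \<delta>3}"
    have \<rho>: "0 < \<rho>" "\<rho> \<le> \<delta>" "\<rho> \<le> \<delta>1" "\<rho> \<le> \<delta>2" "\<rho> \<le> \<delta>3"
      using pos \<delta>1 \<delta>2 \<delta>3 by (auto simp: \<rho>_def)
    define m where "m r = measure \<mu> (cball x r)" for r
    define n where "n r = measure \<nu> (cball x r)" for r
    have em: "emeasure \<mu> (cball x r) = ennreal (m r)" if "r < \<rho>" for r
    proof -
      have "emeasure \<mu> (cball x r) \<le> emeasure \<mu> (cball x \<delta>2)"
        using that \<rho> \<mu> by (intro emeasure_mono) auto
      then show ?thesis unfolding m_def
        using \<delta>2 by (intro emeasure_eq_ennreal_measure) auto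
    qed
    have en: "emeasure \<nu> (cball x r) = ennreal (n r)" for r
      unfolding n_def using \<nu>fin[of "cball x r"] by (intro emeasure_eq_ennreal_measure) auto
    have npos: "0 < n r" if "0 < r" for r
      using \<nu>pos[OF that, of x] by (simp add: en)
    have mstep: "g * m (\<alpha> * r) \<le> m r" and nstep: "n r \<le> h * n (\<alpha> * r)" if r: "0 < r" "r < \<rho>" for r
    proof -
      have "\<alpha> * r \<le> 1 * r" using \<alpha> r by (intro mult_right_mono) auto
      then have ar: "0 < \<alpha> * r" "\<alpha> * r < \<rho>" using \<alpha> r by (simp, linarith)
      have "ennreal g * ennreal (m (\<alpha> * r)) < ennreal (m r)"
        using \<delta>1(2)[of r] r ar \<rho> by (simp add: em)
      then have "ennreal (g * m (\<alpha> * r)) < ennreal (m r)"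
        using h by (simp add: ennreal_mult' m_def)
      then show "g * m (\<alpha> * r) \<le> m r" by (auto simp: ennreal_less_iff m_def h(4) less_imp_le)
      have "ennreal (n r) / ennreal (n (\<alpha> * r)) < ennreal h"
        using \<delta>3(2)[of r] r \<rho> by (simp add: en)
      moreover have "ennreal (n r) / ennreal (n (\<alpha> * r)) = ennreal (n r / n (\<alpha> * r))"
        using npos[OF ar(1)] by (intro divide_ennreal) (simp add: n_def)
      ultimately have "n r / n (\<alpha> * r) < h"
        by (simp add: ennreal_less_iff n_def)
      then show "n r \<le> h * n (\<alpha> * r)"
        using npos[OF ar(1)] by (simp add: divide_less_eq)
    qed
    \<comment> \<open>Starting at half of \<open>\<rho>\<close> keeps every radius strictly below
      \<open>\<rho>\<close>, where all the estimates hold.\<close>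
    define s where "s k = \<alpha> ^ k * (\<rho> / 2)" for k
    have s: "0 < s k" "s k < \<rho>" for k
    proof -
      have "\<alpha> ^ k \<le> 1" using \<alpha> by (intro power_le_one) auto
      then have "s k \<le> 1 * (\<rho> / 2)" unfolding s_def using \<rho> by (intro mult_right_mono) auto
      then show "0 < s k" "s k < \<rho>" using \<rho> \<alpha> by (auto simp: s_def)
    qed
    have s_Suc: "s (Suc k) = \<alpha> * s k" for k by (simp add: s_def)
    have mk: "g ^ k * m (s k) \<le> m (s 0)" for k
    proof (induction k)
      case (Suc k)
      have "g ^ k * (g * m (s (Suc k))) \<le> g ^ k * m (s k)"
        unfolding s_Suc using s h by (intro mult_left_mono mstep) auto
      with Suc show ?case by (simp add: mult_ac)
    qed simp
    have nk: "n (s 0) \<le> h ^ k * n (s k)" for k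
    proof (induction k)
      case (Suc k)
      have "h ^ k * n (s k) \<le> h ^ k * (h * n (s (Suc k)))"
        unfolding s_Suc using s h by (intro mult_left_mono nstep) auto
      with Suc show ?case by (simp add: mult_ac)
    qed simp
    have m0: "0 < m (s 0) + 1" by (simp add: m_def add_nonneg_pos)
    then have "0 < \<epsilon> * n (s 0) / (m (s 0) + 1)"
      using pos npos[OF s(1)] by (intro divide_pos_pos) auto
    then obtain k where k: "(h / g) ^ k < \<epsilon> * n (s 0) / (m (s 0) + 1)"
      using real_arch_pow_inv[of _ "h / g"] h by auto
    have "m (s k) \<le> \<epsilon> * n (s k)"
    proof -
      have "g ^ k * m (s k) * h ^ k \<le> (m (s 0) + 1) * h ^ k"
        using mk[of k] h by (intro mult_right_mono) auto
      also have "\<dots> = (h / g) ^ k * (m (s 0) + 1) * g ^ k" using h by (simp add: power_divide)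
      also have "\<dots> \<le> \<epsilon> * n (s 0) * g ^ k"
        using k h m0 by (intro mult_right_mono) (simp_all add: pos_less_divide_eq less_imp_le)
      also have "\<dots> \<le> \<epsilon> * (h ^ k * n (s k)) * g ^ k"
        using nk[of k] pos h by (intro mult_right_mono mult_left_mono) auto
      finally have "(g ^ k * h ^ k) * m (s k) \<le> (g ^ k * h ^ k) * (\<epsilon> * n (s k))"
        by (simp add: mult_ac)
      then show ?thesis using h by (simp add: mult_le_cancel_left)
    qed
    then have "emeasure \<mu> (cball x (s k)) \<le> ennreal \<epsilon> * emeasure \<nu> (cball x (s k))"
      using s pos by (simp add: em en ennreal_leI flip: ennreal_mult')
    moreover have "0 < s k" "s k < \<delta>" using s[of k] \<rho> by auto
    ultimately show ?thesis by blast
  qed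
  \<comment> \<open>\<open>null_if_small_balls\<close> needs an open set of finite
    \<open>\<nu>\<close>-measure. Bounded sets have this property, so the space is exhausted by
    balls about an arbitrary point, here \<open>undefined\<close>.\<close>
  have "\<exists>Y\<in>null_sets \<mu>. Z \<inter> ball undefined (real n) \<subseteq> Y" for n
    using \<nu>fin[of "ball undefined (real n)"] small
    by (intro null_if_small_balls[OF sep dl \<mu> \<nu>set, of "ball undefined (real n)"]) auto
  then obtain Y where Y: "\<And>n. Y n \<in> null_sets \<mu>" "\<And>n. Z \<inter> ball undefined (real n) \<subseteq> Y n"
    by metis
  have "Z \<subseteq> (\<Union>n. Y n)"
  proof
    fix x assume "x \<in> Z"
    obtain n where "dist undefined x < real n" using reals_Archimedean2 by blast
    with \<open>x \<in> Z\<close> Y(2)[of n] show "x \<in> (\<Union>n. Y n)" by auto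
  qed
  moreover have "(\<Union>n. Y n) \<in> null_sets \<mu>" using Y by (intro null_sets_UN) auto
  ultimately show ?thesis
  proof (intro that)
    fix x and \<delta> :: real assume "x \<in> U - (\<Union>n. Y n)" "0 < \<delta>"
    then have "x \<in> U" "x \<notin> Z" using \<open>Z \<subseteq> (\<Union>n. Y n)\<close> by blast+
    with \<open>0 < \<delta>\<close> show "\<exists>r. 0 < r \<and> r < \<delta> \<and>
        emeasure \<mu> (cball x r) \<le> ennreal g * emeasure \<mu> (cball x (\<alpha> * r))"
      unfolding Z_def using not_le by blast
  qed
qed

text \<open>Points all of whose balls have infinite measure; there \<open>good_radii\<close> is not available.\<close>

lemma packing_open_eq_top:
  assumes C: "1 \<le> C" and "0 < r\<^sub>0" "0 < \<alpha>"
    and q: "\<And>x r. 0 < r \<Longrightarrow> r < r\<^sub>0 \<Longrightarrow> ennreal (1 / C) * emeasure \<mu> (cball x (\<alpha> * r)) \<le> q (cball x r)"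
    and U: "open U" "x \<in> U" and inf: "\<And>r. 0 < r \<Longrightarrow> emeasure \<mu> (cball x r) = \<infinity>"
  shows "packing_open q U = \<infinity>"
proof -
  have "packing_size q \<delta> U = \<infinity>" if "0 < \<delta>" for \<delta>
  proof -
    obtain e where e: "0 < e" "cball x e \<subseteq> U"
      using U open_contains_cball by blast
    define r where "r = Min {e, \<delta> / 2, r\<^sub>0 / 2}"
    have r: "0 < r" "r \<le> e" "r < \<delta>" "r < r\<^sub>0"
      using e \<open>0 < \<delta>\<close> \<open>0 < r\<^sub>0\<close> by (auto simp: r_def min_less_iff_disj)
    then have "cball x r \<subseteq> U" using e by auto
    with r have "packing U \<delta> {cball x r}" by (auto simp: packing_def)
    from sum_le_packing_size[OF this, of q] have "q (cball x r) \<le> packing_size q \<delta> U" by simp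
    moreover have "\<infinity> \<le> q (cball x r)"
      using q[of r x] inf[of "\<alpha> * r"] r C \<open>0 < \<alpha>\<close> by (simp add: ennreal_mult_top)
    ultimately show ?thesis by (simp add: top_unique)
  qed
  then have "\<infinity> \<le> packing_open q U"
    unfolding packing_open_def by (intro INF_greatest) simp
  then show ?thesis by (simp add: top_unique)
qed

text \<open>Apart from the degenerate case, \<open>U\<close> is a countable union of open sets of
  finite measure. Inside finite unions \<open>W\<close> of these, the Vitali theorem selects balls
  with \<open>\<mu>\<close> at most \<open>g * C * q\<close>. They also form a packing of
  \<open>U\<close>, so the bound is uniform in \<open>W\<close>.\<close>

lemma measure_le_packing_open:
  fixes \<mu> \<nu> :: "'a::metric_space measure"
  assumes sep: "separable_space (euclidean :: 'a topology)"
    and dl: "directionally_limited_at \<xi> \<eta> \<zeta> (UNIV :: 'a set)" "\<eta> \<le> 1/3" "0 < \<xi>"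
    and \<alpha>: "0 < \<alpha>" "\<alpha> \<le> 1" and \<gamma>: "1 \<le> \<gamma>"
    and \<nu>: "asymptotically_bounded_measure \<alpha> \<gamma> \<nu>"
    and \<mu>: "sets \<mu> = sets borel"
    and C: "1 \<le> C" "0 < r\<^sub>0"
    and q: "\<And>x r. 0 < r \<Longrightarrow> r < r\<^sub>0 \<Longrightarrow> ennreal (1 / C) * emeasure \<mu> (cball x (\<alpha> * r)) \<le> q (cball x r)"
    and U: "open U"
  shows "ennreal (1 / (\<gamma> * C)) * emeasure \<mu> U \<le> packing_open q U"
proof (cases "\<forall>x\<in>U. \<exists>r>0. emeasure \<mu> (cball x r) < \<infinity>")
  case False
  then obtain x where x: "x \<in> U" "\<And>r. 0 < r \<Longrightarrow> emeasure \<mu> (cball x r) = \<infinity>"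
    by (auto simp: not_less top_unique) (meson not_le)
  then have "packing_open q U = \<infinity>"
    using packing_open_eq_top[OF C \<alpha>(1) q U] by blast
  then show ?thesis by simp
next
  case True
  have main: "emeasure \<mu> U \<le> ennreal (g * C) * packing_size q \<delta> U" if g: "\<gamma> < g" and "0 < \<delta>" for g \<delta>
  proof -
    have gC: "0 < g" "0 < C" using g \<gamma> C by auto
    obtain Y where Y: "Y \<in> null_sets \<mu>" and good: "\<And>x \<delta>. x \<in> U - Y \<Longrightarrow> 0 < \<delta> \<Longrightarrow> \<exists>r. 0 < r \<and> r < \<delta> \<and>
      emeasure \<mu> (cball x r) \<le> ennreal g * emeasure \<mu> (cball x (\<alpha> * r))"
      by (rule good_radii[OF sep dl \<alpha> \<gamma> g \<nu> \<mu>, of U]) (use True in blast)+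
    have "\<exists>V. open V \<and> x \<in> V \<and> V \<subseteq> U \<and> emeasure \<mu> V < \<infinity>" if x: "x \<in> U" for x
    proof -
      obtain r where r: "0 < r" "emeasure \<mu> (cball x r) < \<infinity>" using True x by blast
      have "emeasure \<mu> (ball x r \<inter> U) \<le> emeasure \<mu> (cball x r)"
        using \<mu> by (intro emeasure_mono) auto
      also note r(2)
      finally show ?thesis using x U r by (intro exI[of _ "ball x r \<inter> U"]) auto
    qed
    then obtain V where V: "\<And>x. x \<in> U \<Longrightarrow> open (V x) \<and> x \<in> V x \<and> V x \<subseteq> U \<and> emeasure \<mu> (V x) < \<infinity>"
      by metis
    obtain S where S: "S \<subseteq> U" "countable S" "U \<subseteq> (\<Union>x\<in>S. V x)"
      by (rule separable_countable_subcover[OF sep, of U V]) (use V in blast)+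
    have "emeasure \<mu> (\<Union>x\<in>S. V x) \<le> ennreal (g * C) * packing_size q \<delta> U"
    proof (rule emeasure_countable_UN_le[OF S(2)])
      fix F assume F: "finite F" "F \<subseteq> S"
      define W where "W = (\<Union>x\<in>F. V x)"
      have VF: "open (V x) \<and> V x \<subseteq> U \<and> emeasure \<mu> (V x) < \<infinity>" if "x \<in> F" for x
        using that F(2) S(1) V by blast
      then have W: "open W" "W \<subseteq> U" by (auto simp: W_def)
      have "emeasure \<mu> W \<le> (\<Sum>x\<in>F. emeasure \<mu> (V x))"
        unfolding W_def using F(1) VF \<mu> by (intro emeasure_subadditive_finite) (auto intro!: borel_open)
      also have "\<dots> < \<infinity>" using F(1) VF by auto
      finally have Wfin: "emeasure \<mu> W < \<infinity>" .
      \<comment> \<open>The predicate sees a ball only as a set, which may have several centres and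
        radii. It therefore records one pair that satisfies the size restrictions and the good
        inequality simultaneously.\<close>
      let ?P = "\<lambda>B. \<exists>x r. 0 < r \<and> r < \<delta> \<and> r < r\<^sub>0 \<and> B = cball x r \<and>
        emeasure \<mu> (cball x r) \<le> ennreal g * emeasure \<mu> (cball x (\<alpha> * r))"
      show "emeasure \<mu> (\<Union>x\<in>F. V x) \<le> ennreal (g * C) * packing_size q \<delta> U"
        unfolding W_def[symmetric]
      proof (rule dense_le)
        fix c assume c: "c < emeasure \<mu> W"
        have fine: "\<exists>r. 0 < r \<and> r < d \<and> ?P (cball x r)" if x: "x \<in> W - Y" and d: "0 < d" for x d
        proof -
          have "0 < Min {d, \<delta>, r\<^sub>0}" "x \<in> U - Y" using x d W \<open>0 < \<delta>\<close> C by auto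
          from good[OF this(2,1)] show ?thesis by auto
        qed
        obtain G where G: "ball_packing ?P W G" "c < emeasure \<mu> (\<Union>G)"
          using vitali_besicovitch[OF sep dl \<mu> W(1) Wfin Y fine c] by blast
        have "finite G" "disjoint G" using G(1) by (auto simp: ball_packing_def)
        have GP: "?P B" if "B \<in> G" for B using G(1) that by (simp only: ball_packing_def)
        have "\<Union>G \<subseteq> U" using G(1) W(2) by (auto simp: ball_packing_def)
        moreover have "\<forall>B\<in>G. \<exists>x r. 0 < r \<and> r < \<delta> \<and> B = cball x r" using GP by meson
        ultimately have pack: "packing U \<delta> G"
          using \<open>finite G\<close> \<open>disjoint G\<close> by (simp only: packing_def countable_finite)
        have "(\<Sum>B\<in>G. emeasure \<mu> B) = emeasure \<mu> (\<Union>B\<in>G. B)"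
          using \<open>finite G\<close> \<open>disjoint G\<close> ball_packing_closed[OF G(1)] \<mu>
          by (intro sum_emeasure) (auto simp: disjoint_family_on_def pairwise_def disjnt_def)
        then have "emeasure \<mu> (\<Union>G) = (\<Sum>B\<in>G. emeasure \<mu> B)" by simp
        also have "\<dots> \<le> (\<Sum>B\<in>G. ennreal (g * C) * q B)"
        proof (rule sum_mono)
          fix B assume "B \<in> G"
          then obtain x r where xr: "0 < r" "r < r\<^sub>0" "B = cball x r"
            "emeasure \<mu> B \<le> ennreal g * emeasure \<mu> (cball x (\<alpha> * r))"
            using GP by blast
          have "emeasure \<mu> (cball x (\<alpha> * r))
              = ennreal C * (ennreal (1 / C) * emeasure \<mu> (cball x (\<alpha> * r)))"
            using gC by (simp add: mult.assoc[symmetric] flip: ennreal_mult')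
          also have "\<dots> \<le> ennreal C * q B"
            using q[OF xr(1,2), of x] xr(3) by (intro mult_left_mono) auto
          finally have "ennreal g * emeasure \<mu> (cball x (\<alpha> * r)) \<le> ennreal g * (ennreal C * q B)"
            by (rule mult_left_mono) simp
          with xr(4) show "emeasure \<mu> B \<le> ennreal (g * C) * q B"
            using gC by (simp add: ennreal_mult' mult.assoc)
        qed
        also have "\<dots> = ennreal (g * C) * sum q G" by (simp add: sum_distrib_left)
        also have "\<dots> \<le> ennreal (g * C) * packing_size q \<delta> U"
          by (intro mult_left_mono sum_le_packing_size pack \<open>finite G\<close>) auto
        finally show "c \<le> ennreal (g * C) * packing_size q \<delta> U" using G(2) by simp
      qed
    qed (use S V \<mu> in \<open>auto intro!: borel_open\<close>)
    moreover have "emeasure \<mu> U \<le> emeasure \<mu> (\<Union>x\<in>S. V x)"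
      using S V \<mu> by (intro emeasure_mono) (auto intro!: borel_open)
    ultimately show ?thesis by (rule order_trans[rotated])
  qed
  have approx: "ennreal (1 / (g * C)) * emeasure \<mu> U \<le> packing_open q U" if g: "\<gamma> < g" for g
    unfolding packing_open_def
  proof (rule INF_greatest)
    fix \<delta> :: real assume \<delta>: "\<delta> \<in> {0<..}"
    have pos: "0 < g * C" and gC: "g \<noteq> 0" "C \<noteq> 0" using g \<gamma> C by auto
    have "ennreal (1 / (g * C)) * emeasure \<mu> U \<le> ennreal (1 / (g * C)) * (ennreal (g * C) * packing_size q \<delta> U)"
      using main[OF g] \<delta> by (intro mult_left_mono) auto
    also have "\<dots> = ennreal (1 / (g * C) * (g * C)) * packing_size q \<delta> U"
      using pos by (simp only: ennreal_mult mult.assoc divide_nonneg_nonneg less_imp_le zero_le_one)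
    also have "\<dots> = packing_size q \<delta> U" using gC by simp
    finally show "ennreal (1 / (g * C)) * emeasure \<mu> U \<le> packing_size q \<delta> U" .
  qed
  \<comment> \<open>The estimate is available for \<open>g > \<gamma>\<close> only, and the sharp
    constant follows by letting \<open>g\<close> decrease to \<open>\<gamma>\<close>. If
    \<open>\<mu>\<close> is infinite on \<open>U\<close>, the single value
    \<open>\<gamma> + 1\<close> suffices.\<close>
  show ?thesis
  proof (cases "emeasure \<mu> U")
    case (real u)
    have "((\<lambda>g. ennreal (1 / (g * C) * u)) \<longlongrightarrow> ennreal (1 / (\<gamma> * C) * u)) (at_right \<gamma>)"
      using \<gamma> C by (intro tendsto_intros) auto
    moreover have mult: "ennreal (1 / (g * C) * u) = ennreal (1 / (g * C)) * ennreal u" for g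
      using real(1) by (rule ennreal_mult'')
    have "\<forall>\<^sub>F g in at_right \<gamma>. ennreal (1 / (g * C) * u) \<le> packing_open q U"
      using eventually_at_right_less
      by (rule eventually_mono) (use approx real(2) in \<open>simp only: mult\<close>)
    ultimately have "ennreal (1 / (\<gamma> * C) * u) \<le> packing_open q U"
      by (intro tendsto_upperbound[of _ _ "at_right \<gamma>"]) auto
    then show ?thesis using real(2) by (simp only: mult)
  next
    case top
    have "0 < 1 / ((\<gamma> + 1) * C)" using \<gamma> C by auto
    then have "ennreal (1 / ((\<gamma> + 1) * C)) \<noteq> 0" by (simp only: ennreal_eq_0_iff not_le)
    with approx[of "\<gamma> + 1"] top show ?thesis by (simp add: ennreal_mult_top)
  qed
qed

subsection \<open>The packing measure as a metric outer measure\<close>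

lemma packing_size_tendsto: "(\<lambda>k. packing_size q (1 / Suc k) U) \<longlonglongrightarrow> packing_open q U"
proof -
  have "packing_open q U = (INF k. packing_size q (1 / Suc k) U)"
    unfolding packing_open_def
  proof (rule INF_eq)
    fix \<delta> :: real assume "\<delta> \<in> {0<..}"
    then obtain k where "inverse (Suc k) < \<delta>" using reals_Archimedean by auto
    then show "\<exists>k\<in>UNIV. packing_size q (1 / Suc k) U \<le> packing_size q \<delta> U"
      by (intro bexI[of _ k] packing_size_mono) (auto simp: inverse_eq_divide)
  qed auto
  moreover have "decseq (\<lambda>k. packing_size q (1 / Suc k) U)"
    by (intro decseq_SucI packing_size_mono) (auto simp: field_simps)
  ultimately show ?thesis using LIMSEQ_INF by metis
qed

text \<open>Packings of two disjoint sets together form a packing of the union.\<close>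

lemma packing_open_add_le_Un:
  assumes disj: "U \<inter> V = {}"
  shows "packing_open q U + packing_open q V \<le> packing_open q (U \<union> V)"
proof -
  have "packing_open q U + packing_open q V \<le> packing_size q \<delta> (U \<union> V)" if "0 < \<delta>" for \<delta>
  proof -
    define X where "X = packing_size q \<delta> (U \<union> V)"
    have *: "sum q G + sum q H \<le> X"
      if "finite G" "packing U \<delta> G" "finite H" "packing V \<delta> H" for G H
    proof -
      have "\<Union>G \<subseteq> U" "\<Union>H \<subseteq> V" using that by (auto simp: packing_def)
      with disj have dj: "\<Union>G \<inter> \<Union>H = {}" by blast
      \<comment> \<open>Members of both packings would lie in the empty set
        \<open>U \<inter> V\<close>; as balls are nonempty, \<open>G\<close> and \<open>H\<close>
        share no member and the sums add up.\<close>
      have "{} \<notin> G"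
      proof
        assume "{} \<in> G"
        moreover have "\<forall>B\<in>G. \<exists>x r. 0 < r \<and> r < \<delta> \<and> B = cball x r"
          using \<open>packing U \<delta> G\<close> by (simp add: packing_def)
        ultimately show False by (metis cball_eq_empty less_asym)
      qed
      have "G \<inter> H = {}"
      proof (rule ccontr)
        assume "G \<inter> H \<noteq> {}"
        then obtain B where B: "B \<in> G" "B \<in> H" by blast
        then obtain y where "y \<in> B" using \<open>{} \<notin> G\<close> by (cases "B = {}") auto
        with B dj show False by blast
      qed
      then have "sum q G + sum q H = sum q (G \<union> H)"
        using that by (simp add: sum.union_disjoint)
      also have "\<dots> \<le> X"
        unfolding X_def
      proof (rule sum_le_packing_size)
        have "disjoint (G \<union> H)"
          using that dj by (intro disjoint_union) (auto simp: packing_def)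
        then show "packing (U \<union> V) \<delta> (G \<union> H)"
          using that by (auto simp: packing_def)
      qed (use that in auto)
      finally show ?thesis .
    qed
    \<comment> \<open>The suprema over \<open>G\<close> and \<open>H\<close> are taken one after the
      other. Meanwhile the other summand is moved across by subtraction, which is legitimate because
      \<open>X\<close> is finite.\<close>
    have "packing_size q \<delta> U + packing_size q \<delta> V \<le> X"
    proof (cases "X = \<infinity>")
      case False
      have minus: "a \<le> X - b" if "a + b \<le> X" for a b :: ennreal
      proof -
        have "b \<le> X" using that by (rule order_trans[rotated]) simp
        then have "b \<noteq> \<infinity>" using False by (auto simp: top_unique)
        then show ?thesis using ennreal_minus_mono[OF that order_refl, of b] by simp
      qed
      have plus: "a + b \<le> X" if "a \<le> X - b" "b \<le> X" for a b :: ennreal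
        using add_right_mono[OF that(1), of b] that(2) by (simp add: diff_add_cancel_ennreal)
      have 1: "packing_size q \<delta> U \<le> X - sum q H" if "finite H" "packing V \<delta> H" for H
        using * that by (intro packing_size_le minus) auto
      have 2: "sum q H \<le> X" if "finite H" "packing V \<delta> H" for H
        using *[of "{}" H] that by (auto simp: packing_def)
      have "packing_size q \<delta> V \<le> X - packing_size q \<delta> U"
        using plus[OF 1 2] by (intro packing_size_le minus) (auto simp: add.commute)
      moreover have "packing_size q \<delta> U \<le> X"
        unfolding X_def by (intro packing_size_mono) auto
      ultimately show ?thesis using plus[of "packing_size q \<delta> V" "packing_size q \<delta> U"]
        by (simp add: add.commute)
    qed simp
    moreover have "packing_open q U + packing_open q V \<le> packing_size q \<delta> U + packing_size q \<delta> V"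
      using that by (intro add_mono packing_open_le_size)
    ultimately show ?thesis unfolding X_def by (rule order_trans[rotated])
  qed
  then show ?thesis unfolding packing_open_def[of q "U \<union> V"] by (intro INF_greatest) auto
qed

lemma packing_measure_mono: "A \<subseteq> B \<Longrightarrow> packing_measure q A \<le> packing_measure q B"
  unfolding packing_measure_def by (intro INF_superset_mono) auto

lemma packing_measure_open: "open U \<Longrightarrow> packing_measure q U = packing_open q U"
  unfolding packing_measure_def
  by (intro antisym INF_lower2[of U] INF_greatest packing_open_mono) auto

text \<open>The \<open>s / 2\<close>-neighbourhoods of \<open>E\<close> and \<open>F\<close> are
  disjoint. Cutting an open superset down to them reduces the claim to disjoint open sets.\<close>

lemma packing_measure_add_le_Un:
  assumes sep: "0 < s" "\<And>x y. x \<in> E \<Longrightarrow> y \<in> F \<Longrightarrow> s \<le> dist x y"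
  shows "packing_measure q E + packing_measure q F \<le> packing_measure q (E \<union> F)"
  unfolding packing_measure_def[of q "E \<union> F"]
proof (rule INF_greatest)
  fix W assume "W \<in> {U. open U \<and> E \<union> F \<subseteq> U}"
  then have W: "open W" "E \<subseteq> W" "F \<subseteq> W" by auto
  define U where "U = W \<inter> (\<Union>x\<in>E. ball x (s / 2))"
  define V where "V = W \<inter> (\<Union>x\<in>F. ball x (s / 2))"
  have "open U" "E \<subseteq> U" "open V" "F \<subseteq> V" using W sep(1) by (auto simp: U_def V_def)
  then have "packing_measure q E + packing_measure q F \<le> packing_open q U + packing_open q V"
    using packing_measure_mono[of E U q] packing_measure_mono[of F V q]
    by (simp add: packing_measure_open add_mono)
  also have "\<dots> \<le> packing_open q (U \<union> V)"
  proof (rule packing_open_add_le_Un)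
    show "U \<inter> V = {}"
    proof (rule ccontr)
      assume "U \<inter> V \<noteq> {}"
      then obtain p x y where "x \<in> E" "y \<in> F" "dist x p < s / 2" "dist y p < s / 2"
        by (auto simp: U_def V_def)
      then show False
        using sep(2)[of x y] dist_triangle_half_l[of x p s y] by (simp add: dist_commute)
    qed
  qed
  also have "\<dots> \<le> packing_open q W" by (intro packing_open_mono) (auto simp: U_def V_def)
  finally show "packing_measure q E + packing_measure q F \<le> packing_open q W" .
qed

section \<open>Countable sub-additivity from a two-sided comparison\<close>

text \<open>Isolates what the rest of the argument uses: the upper bound on small balls and a lower
  bound on open sets. The latter comes from \<open>measure_le_packing_open\<close> with
  \<open>c = 1 / (\<gamma> * C)\<close>.\<close>

locale comparable_premeasure =
  fixes \<mu> :: "'a::metric_space measure" and q :: "'a set \<Rightarrow> ennreal" and C c r\<^sub>0 :: real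
  assumes sets_borel: "sets \<mu> = sets borel"
    and pos: "0 < C" "0 < c" "0 < r\<^sub>0"
    and upper: "\<And>x r. 0 < r \<Longrightarrow> r < r\<^sub>0 \<Longrightarrow> q (cball x r) \<le> ennreal C * emeasure \<mu> (cball x r)"
    and lower: "\<And>U. open U \<Longrightarrow> ennreal c * emeasure \<mu> U \<le> packing_open q U"
begin

text \<open>The set \<open>S\<close> may be much smaller than \<open>U\<close>: it will be the set
  of small measure that holds the balls missed by a decomposition.\<close>

lemma packing_sum_le:
  assumes G: "finite G" "packing U \<delta> G" and "\<delta> \<le> r\<^sub>0" and S: "\<Union>G \<subseteq> S" "S \<in> sets borel"
  shows "sum q G \<le> ennreal C * emeasure \<mu> S"
proof -
  have closed: "closed B" if "B \<in> G" for B using that G by (auto simp: packing_def)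
  have "sum q G \<le> (\<Sum>B\<in>G. ennreal C * emeasure \<mu> B)"
  proof (rule sum_mono)
    fix B assume "B \<in> G"
    then obtain x r where "0 < r" "r < \<delta>" "B = cball x r" using G by (auto simp: packing_def)
    then show "q B \<le> ennreal C * emeasure \<mu> B" using upper[of r x] \<open>\<delta> \<le> r\<^sub>0\<close> by simp
  qed
  also have "\<dots> = ennreal C * (\<Sum>B\<in>G. emeasure \<mu> B)" by (simp add: sum_distrib_left)
  also have "(\<Sum>B\<in>G. emeasure \<mu> B) = emeasure \<mu> (\<Union>B\<in>G. B)"
    using G closed sets_borel
    by (intro sum_emeasure) (auto simp: packing_def disjoint_family_on_def pairwise_def disjnt_def)
  also have "ennreal C * \<dots> \<le> ennreal C * emeasure \<mu> S"
    using S sets_borel by (intro mult_left_mono emeasure_mono) auto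
  finally show ?thesis .
qed

lemma packing_open_le: "open U \<Longrightarrow> packing_open q U \<le> ennreal C * emeasure \<mu> U"
  by (rule order_trans[OF packing_open_le_size[of r\<^sub>0] packing_size_le])
     (use pos in \<open>auto intro: packing_sum_le simp: packing_def\<close>)

lemma packing_measure_empty: "packing_measure q {} = 0"
  using packing_open_le[of "{}"] by (simp add: packing_measure_open)

text \<open>A ball of radius less than \<open>\<delta>\<close> containing a point at distance at least \<open>2\<delta>\<close> from \<open>- U i\<close> lies in \<open>U i\<close>.\<close>

lemma packing_size_UN_le:
  fixes U :: "nat \<Rightarrow> 'a set"
  assumes U: "\<And>i. i < n \<Longrightarrow> open (U i)" and V: "open V" and "\<delta> \<le> r\<^sub>0"
  shows "packing_size q \<delta> V \<le> (\<Sum>i<n. packing_size q \<delta> (U i)) +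
    ennreal C * emeasure \<mu> (V - (\<Union>i<n. - (\<Union>z\<in>- U i. ball z (2 * \<delta>))))"
proof (rule packing_size_le)
  fix G assume G: "finite G" "packing V \<delta> G"
  define H where "H = {B\<in>G. \<forall>i<n. \<not> B \<subseteq> U i}"
  \<comment> \<open>The points of \<open>V\<close> closer than \<open>2 * \<delta>\<close> to each
    of the complements \<open>- U i\<close>; balls contained in no \<open>U i\<close> are confined
    to this set.\<close>
  define E where "E = V - (\<Union>i<n. - (\<Union>z\<in>- U i. ball z (2 * \<delta>)))"
  have sub: "packing W \<delta> {B\<in>G. P B}" if "\<And>B. B \<in> G \<Longrightarrow> P B \<Longrightarrow> B \<subseteq> W" for P W
    using G that by (auto simp: packing_def pairwise_def)
  \<comment> \<open>A ball contained in several of the \<open>U i\<close> is counted repeatedly,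
    which only enlarges the right-hand side.\<close>
  have "sum q G \<le> (\<Sum>B\<in>G. (\<Sum>i<n. if B \<subseteq> U i then q B else 0) + (if \<forall>i<n. \<not> B \<subseteq> U i then q B else 0))"
  proof (rule sum_mono)
    fix B
    show "q B \<le> (\<Sum>i<n. if B \<subseteq> U i then q B else 0) + (if \<forall>i<n. \<not> B \<subseteq> U i then q B else 0)"
    proof (cases "\<forall>i<n. \<not> B \<subseteq> U i")
      case False
      then obtain i where i: "i < n" "B \<subseteq> U i" by blast
      then have "q B = (if B \<subseteq> U i then q B else 0)" by simp
      also have "\<dots> \<le> (\<Sum>i<n. if B \<subseteq> U i then q B else 0)"
        using i by (intro member_le_sum) auto
      finally show ?thesis using False by simp
    qed simp
  qed
  also have "\<dots> = (\<Sum>i<n. sum q {B\<in>G. B \<subseteq> U i}) + sum q H"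
    using G(1) by (simp add: sum.distrib sum.swap[of _ G] sum.inter_filter H_def)
  also have "\<dots> \<le> (\<Sum>i<n. packing_size q \<delta> (U i)) + ennreal C * emeasure \<mu> E"
  proof (intro add_mono sum_mono)
    fix i
    show "sum q {B\<in>G. B \<subseteq> U i} \<le> packing_size q \<delta> (U i)"
      using G(1) by (intro sum_le_packing_size sub) auto
  next
    show "sum q H \<le> ennreal C * emeasure \<mu> E"
    proof (rule packing_sum_le[OF _ _ \<open>\<delta> \<le> r\<^sub>0\<close>])
      show "packing V \<delta> H" unfolding H_def using G(2) by (intro sub) (auto simp: packing_def)
      show "E \<in> sets borel"
        unfolding E_def by (intro sets.Diff sets.finite_UN borel_comp borel_open open_UN ballI open_ball V) simp
      show "\<Union>H \<subseteq> E"
      proof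
        fix y assume "y \<in> \<Union>H"
        then obtain B where B: "B \<in> G" "y \<in> B" "\<And>i. i < n \<Longrightarrow> \<not> B \<subseteq> U i" by (auto simp: H_def)
        then obtain x r where xr: "r < \<delta>" "B = cball x r" using G by (auto simp: packing_def)
        have "y \<in> (\<Union>z\<in>- U i. ball z (2 * \<delta>))" if i: "i < n" for i
        proof -
          obtain z where "z \<in> B" "z \<notin> U i" using B(3)[OF i] by blast
          moreover have "dist z y < 2 * \<delta>"
            using dist_triangle[of z y x] \<open>z \<in> B\<close> B(2) xr by (simp add: dist_commute)
          ultimately show ?thesis by auto
        qed
        moreover have "y \<in> V" using G(2) B by (auto simp: packing_def)
        ultimately show "y \<in> E" by (auto simp: E_def)
      qed
    qed (use G(1) in \<open>auto simp: H_def\<close>)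
  qed
  finally show "sum q G \<le> (\<Sum>i<n. packing_size q \<delta> (U i)) +
    ennreal C * emeasure \<mu> (V - (\<Union>i<n. - (\<Union>z\<in>- U i. ball z (2 * \<delta>))))"
    unfolding E_def .
qed

text \<open>Let \<open>\<delta>\<close> tend to 0 in \<open>packing_size_UN_le\<close>. Because the
  \<open>U i\<close> are open, the exceptional sets decrease to what they leave uncovered in
  \<open>V\<close>; the finite measure of \<open>V\<close> gives continuity from above. With
  finitely many \<open>U i\<close> the limit can be taken termwise.\<close>

lemma packing_open_finite_UN_le:
  fixes U :: "nat \<Rightarrow> 'a set"
  assumes U: "\<And>i. i < n \<Longrightarrow> open (U i)" and V: "open V" "emeasure \<mu> V < \<infinity>"
  shows "packing_open q V \<le> (\<Sum>i<n. packing_open q (U i)) +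
    ennreal C * emeasure \<mu> (V - (\<Union>i<n. U i))"
proof -
  define \<delta> where "\<delta> k = 1 / real (Suc k)" for k
  define E where "E k = V - (\<Union>i<n. - (\<Union>z\<in>- U i. ball z (2 * \<delta> k)))" for k
  have \<delta>: "\<delta> j \<le> \<delta> k" if "k \<le> j" for j k using that by (simp add: \<delta>_def frac_le)
  have int: "(\<Inter>k. E k) = V - (\<Union>i<n. U i)"
  proof (intro equalityI subsetI)
    fix x assume x: "x \<in> (\<Inter>k. E k)"
    have "x \<notin> U i" if i: "i < n" for i
    proof
      assume "x \<in> U i"
      then obtain e where e: "0 < e" "ball x e \<subseteq> U i" using U[OF i] openE by blast
      then obtain k where k: "inverse (Suc k) < e / 2" using reals_Archimedean[of "e / 2"] by auto
      have "x \<in> E k" using x by blast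
      then obtain z where "z \<notin> U i" "dist z x < 2 * \<delta> k" using i by (auto simp: E_def)
      then have "z \<in> ball x e" using k by (simp add: \<delta>_def inverse_eq_divide dist_commute)
      then show False using e \<open>z \<notin> U i\<close> by blast
    qed
    then show "x \<in> V - (\<Union>i<n. U i)" using x by (auto simp: E_def)
  next
    fix x assume x: "x \<in> V - (\<Union>i<n. U i)"
    have "0 < \<delta> k" for k by (simp add: \<delta>_def)
    then show "x \<in> (\<Inter>k. E k)" using x by (auto simp: E_def intro!: bexI[of _ x])
  qed
  have "(\<lambda>k. emeasure \<mu> (E k)) \<longlonglongrightarrow> emeasure \<mu> (\<Inter>k. E k)"
  proof (rule Lim_emeasure_decseq)
    have "E k \<in> sets borel" for k
      unfolding E_def by (intro sets.Diff sets.finite_UN borel_comp borel_open open_UN ballI open_ball V) simp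
    then show "range E \<subseteq> sets \<mu>" by (auto simp: sets_borel)
    have "E j \<subseteq> E k" if "k \<le> j" for j k
      unfolding E_def using \<delta>[OF that]
      by (intro Diff_mono UN_mono Compl_anti_mono subset_ball order_refl) auto
    then show "decseq E" by (auto simp: decseq_def)
    fix k
    have "emeasure \<mu> (E k) \<le> emeasure \<mu> V"
      using V by (intro emeasure_mono) (auto simp: E_def sets_borel)
    then show "emeasure \<mu> (E k) \<noteq> \<infinity>" using V(2) by (auto simp: top_unique)
  qed
  then have "(\<lambda>k. (\<Sum>i<n. packing_size q (\<delta> k) (U i)) + ennreal C * emeasure \<mu> (E k))
      \<longlonglongrightarrow> (\<Sum>i<n. packing_open q (U i)) + ennreal C * emeasure \<mu> (V - (\<Union>i<n. U i))"
    unfolding int \<delta>_def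
    by (intro tendsto_add tendsto_sum packing_size_tendsto ennreal_tendsto_cmult) auto
  moreover have "\<forall>\<^sub>F k in sequentially. packing_open q V \<le>
      (\<Sum>i<n. packing_size q (\<delta> k) (U i)) + ennreal C * emeasure \<mu> (E k)"
  proof -
    obtain k0 where k0: "inverse (Suc k0) < r\<^sub>0" using reals_Archimedean pos by blast
    show ?thesis
    proof (rule eventually_sequentiallyI[of k0])
      fix k assume "k0 \<le> k"
      then have "\<delta> k \<le> r\<^sub>0" using \<delta>[of k0 k] k0 by (simp add: \<delta>_def inverse_eq_divide)
      from packing_size_UN_le[OF U V(1) this, of n]
      have "packing_size q (\<delta> k) V \<le>
          (\<Sum>i<n. packing_size q (\<delta> k) (U i)) + ennreal C * emeasure \<mu> (E k)"
        by (simp add: E_def)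
      moreover have "packing_open q V \<le> packing_size q (\<delta> k) V"
        by (rule packing_open_le_size) (simp add: \<delta>_def)
      ultimately show "packing_open q V \<le>
          (\<Sum>i<n. packing_size q (\<delta> k) (U i)) + ennreal C * emeasure \<mu> (E k)" by simp
    qed
  qed
  ultimately show ?thesis by (rule tendsto_lowerbound) simp
qed

text \<open>If the right-hand side is finite, \<open>lower\<close> forces the union to have finite
  \<open>\<mu>\<close>-measure. The part missed by the first \<open>n\<close> sets then has measure
  tending to 0, and with it the error term of the finite case.\<close>

lemma packing_open_UN_le:
  assumes U: "\<And>i::nat. open (U i)"
  shows "packing_open q (\<Union>i. U i) \<le> (\<Sum>i. packing_open q (U i))"
proof (cases "(\<Sum>i. packing_open q (U i)) = \<infinity>")
  case False
  define V where "V = (\<Union>i. U i)"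
  have "open V" using U by (auto simp: V_def)
  have Vfin: "emeasure \<mu> V < \<infinity>"
  proof -
    have "ennreal c * emeasure \<mu> V \<le> ennreal c * (\<Sum>i. emeasure \<mu> (U i))"
      unfolding V_def using U by (intro mult_left_mono emeasure_subadditive_countably) (auto simp: sets_borel)
    also have "\<dots> = (\<Sum>i. ennreal c * emeasure \<mu> (U i))" by simp
    also have "\<dots> \<le> (\<Sum>i. packing_open q (U i))" using U by (intro suminf_le lower) auto
    finally have "ennreal c * emeasure \<mu> V < \<infinity>" using False by (auto simp: less_top[symmetric] top_unique)
    then show ?thesis using pos by (auto simp: ennreal_mult_less_top)
  qed
  have "(\<lambda>n. emeasure \<mu> (V - (\<Union>i<n. U i))) \<longlonglongrightarrow> emeasure \<mu> (\<Inter>n. V - (\<Union>i<n. U i))"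
  proof (rule Lim_emeasure_decseq)
    show "range (\<lambda>n. V - (\<Union>i<n. U i)) \<subseteq> sets \<mu>" using U \<open>open V\<close> by (auto simp: sets_borel)
    show "decseq (\<lambda>n. V - (\<Union>i<n. U i))" unfolding decseq_def by fastforce
    fix n
    have "emeasure \<mu> (V - (\<Union>i<n. U i)) \<le> emeasure \<mu> V"
      using \<open>open V\<close> by (intro emeasure_mono) (auto simp: sets_borel)
    then show "emeasure \<mu> (V - (\<Union>i<n. U i)) \<noteq> \<infinity>" using Vfin by (auto simp: top_unique)
  qed
  moreover have "(\<Inter>n. V - (\<Union>i<n. U i)) = {}" unfolding V_def by blast
  ultimately have "(\<lambda>n. emeasure \<mu> (V - (\<Union>i<n. U i))) \<longlonglongrightarrow> 0"
    by (simp only: emeasure_empty)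
  then have "(\<lambda>n. (\<Sum>i<n. packing_open q (U i)) + ennreal C * emeasure \<mu> (V - (\<Union>i<n. U i)))
      \<longlonglongrightarrow> (\<Sum>i. packing_open q (U i)) + ennreal C * 0"
    by (intro tendsto_add summable_LIMSEQ ennreal_tendsto_cmult) auto
  then have "packing_open q V \<le> (\<Sum>i. packing_open q (U i)) + ennreal C * 0"
    by (rule tendsto_lowerbound)
       (auto intro!: always_eventually packing_open_finite_UN_le U \<open>open V\<close> Vfin)
  then show ?thesis by (simp add: V_def)
qed simp

lemma packing_measure_UN_le:
  fixes A :: "nat \<Rightarrow> 'a set"
  shows "packing_measure q (\<Union>i. A i) \<le> (\<Sum>i. packing_measure q (A i))"
proof (rule ennreal_le_epsilon)
  fix e :: real
  assume fin: "(\<Sum>i. packing_measure q (A i)) < top" and "0 < e"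
  have "\<exists>U. open U \<and> A i \<subseteq> U \<and> packing_open q U \<le> packing_measure q (A i) + ennreal (e * (1/2) ^ Suc i)" for i
  proof -
    have "packing_measure q (A i) \<noteq> \<infinity>"
      using ennreal_suminf_lessD[OF fin, of i] by simp
    moreover have "0 < ennreal (e * (1/2) ^ Suc i)"
      using \<open>0 < e\<close> by simp
    ultimately have "packing_measure q (A i) < packing_measure q (A i) + ennreal (e * (1/2) ^ Suc i)"
      by (simp add: ennreal_add_left_cancel_less)
    then show ?thesis
      unfolding packing_measure_def INF_less_iff by (auto intro: less_imp_le)
  qed
  then obtain U where U: "\<And>i. open (U i)" "\<And>i. A i \<subseteq> U i"
    "\<And>i. packing_open q (U i) \<le> packing_measure q (A i) + ennreal (e * (1/2) ^ Suc i)" by metis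
  have "packing_measure q (\<Union>i. A i) \<le> packing_measure q (\<Union>i. U i)"
    using U by (intro packing_measure_mono UN_mono) auto
  also have "\<dots> = packing_open q (\<Union>i. U i)" using U by (intro packing_measure_open) auto
  also have "\<dots> \<le> (\<Sum>i. packing_open q (U i))" by (rule packing_open_UN_le[OF U(1)])
  also have "\<dots> \<le> (\<Sum>i. packing_measure q (A i) + ennreal (e * (1/2) ^ Suc i))"
    by (intro suminf_le U) auto
  also have "\<dots> = (\<Sum>i. packing_measure q (A i)) + (\<Sum>i. ennreal (e * (1/2) ^ Suc i))"
    by (intro suminf_add[symmetric]) auto
  also have "(\<Sum>i. ennreal (e * (1/2) ^ Suc i)) = ennreal e"
    using sums_mult[OF power_half_series, of e] \<open>0 < e\<close> by (intro suminf_ennreal_eq) auto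
  finally show "packing_measure q (\<Union>i. A i) \<le> (\<Sum>i. packing_measure q (A i)) + ennreal e" .
qed

lemma packing_measure_Un_le: "packing_measure q (A \<union> B) \<le> packing_measure q A + packing_measure q B"
  using packing_measure_UN_le[of "binaryset A B"]
  by (simp add: UN_binaryset_eq suminf_binaryset_eq packing_measure_empty)

lemma outer_measure_packing_measure: "outer_measure_space UNIV (packing_measure q)"
  unfolding outer_measure_space_def positive_def increasing_def countably_subadditive_def
  using packing_measure_empty packing_measure_mono packing_measure_UN_le by blast

lemma metric_outer_measure_packing_measure: "metric_outer_measure (packing_measure q)"
  unfolding metric_outer_measure_def
proof (intro conjI allI impI outer_measure_packing_measure)
  fix E F :: "'a set" assume "0 < setdist E F"
  then show "packing_measure q (E \<union> F) = packing_measure q E + packing_measure q F"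
    using setdist_le_dist
    by (intro antisym packing_measure_Un_le packing_measure_add_le_Un[of "setdist E F"]) auto
qed

section \<open>Caratheodory measurability and the Borel restriction\<close>

text \<open>\<open>A \<inter> K\<close> and \<open>A - N k\<close> have positive distance, so their
  packing measures add. The remaining shell lies in the open set
  \<open>(W - K) \<inter> N k\<close>, whose packing measure is controlled by \<open>\<mu>\<close>;
  this takes the place of the usual summation over shells.\<close>

lemma caratheodory_closed:
  assumes K: "closed K"
  shows "packing_measure q (A \<inter> K) + packing_measure q (A - K) \<le> packing_measure q A"
proof (cases "packing_measure q A = \<infinity>")
  case False
  then have "packing_measure q A < \<infinity>" by (simp add: less_top[symmetric])
  then obtain W where W: "open W" "A \<subseteq> W" "packing_open q W < \<infinity>"
    unfolding packing_measure_def by (auto simp: INF_less_iff)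
  have "ennreal c * emeasure \<mu> W < \<infinity>" using lower[OF W(1)] W(3) by (rule le_less_trans)
  then have Wfin: "emeasure \<mu> W < \<infinity>" using pos by (auto simp: ennreal_mult_less_top)
  define N where "N k = (\<Union>y\<in>K. ball y (1 / Suc k))" for k
  have oN: "open (N k)" for k by (auto simp: N_def)
  \<comment> \<open>Since \<open>W\<close> has finite measure, the part of \<open>W - K\<close> close to \<open>K\<close> is negligible.\<close>
  have le: "packing_measure q (A \<inter> K) + packing_measure q (A - K)
      \<le> packing_measure q A + ennreal C * emeasure \<mu> ((W - K) \<inter> N k)" for k
  proof -
    have op: "open ((W - K) \<inter> N k)" using W K oN by auto
    have "packing_measure q (A - K)
        \<le> packing_measure q (A - N k) + packing_measure q ((W - K) \<inter> N k)"
      using W(2) by (intro order_trans[OF packing_measure_mono packing_measure_Un_le]) auto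
    then have "packing_measure q (A \<inter> K) + packing_measure q (A - K)
        \<le> packing_measure q (A \<inter> K) + packing_measure q (A - N k) + packing_measure q ((W - K) \<inter> N k)"
      unfolding add.assoc by (rule add_left_mono)
    also have "packing_measure q (A \<inter> K) + packing_measure q (A - N k)
        \<le> packing_measure q (A \<inter> K \<union> (A - N k))"
      by (rule packing_measure_add_le_Un[of "1 / Suc k"]) (auto simp: N_def not_less)
    also have "\<dots> \<le> packing_measure q A"
      by (intro packing_measure_mono) auto
    also have "packing_measure q ((W - K) \<inter> N k) \<le> ennreal C * emeasure \<mu> ((W - K) \<inter> N k)"
      using packing_open_le[OF op] packing_measure_open[OF op, of q] by simp
    finally show ?thesis by (simp add: add_left_mono add_right_mono)
  qed
  have "(\<lambda>k. emeasure \<mu> ((W - K) \<inter> N k)) \<longlonglongrightarrow> emeasure \<mu> (\<Inter>k. (W - K) \<inter> N k)"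
  proof (rule Lim_emeasure_decseq)
    show "range (\<lambda>k. (W - K) \<inter> N k) \<subseteq> sets \<mu>" using W K oN by (auto simp: sets_borel)
    have "N j \<subseteq> N k" if "k \<le> j" for j k
      unfolding N_def using that by (intro UN_mono subset_ball order_refl frac_le) auto
    then show "decseq (\<lambda>k. (W - K) \<inter> N k)" unfolding decseq_def by blast
    fix k
    have "emeasure \<mu> ((W - K) \<inter> N k) \<le> emeasure \<mu> W"
      using W by (intro emeasure_mono) (auto simp: sets_borel)
    then show "emeasure \<mu> ((W - K) \<inter> N k) \<noteq> \<infinity>" using Wfin by (auto simp: top_unique)
  qed
  moreover have "(\<Inter>k. (W - K) \<inter> N k) = {}"
  proof (rule ccontr)
    assume "(\<Inter>k. (W - K) \<inter> N k) \<noteq> {}"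
    then obtain x where x: "x \<notin> K" "\<And>k. x \<in> N k" by blast
    then obtain e where e: "0 < e" "ball x e \<subseteq> - K" using K openE[of "- K" x] by auto
    then obtain k where k: "inverse (Suc k) < e" using reals_Archimedean by blast
    then show False using x(2)[of k] e(2) by (force simp: N_def inverse_eq_divide dist_commute)
  qed
  ultimately have "(\<lambda>k. emeasure \<mu> ((W - K) \<inter> N k)) \<longlonglongrightarrow> 0"
    by (simp only: emeasure_empty)
  then have "(\<lambda>k. packing_measure q A + ennreal C * emeasure \<mu> ((W - K) \<inter> N k))
      \<longlonglongrightarrow> packing_measure q A + ennreal C * 0"
    by (intro tendsto_add tendsto_const ennreal_tendsto_cmult) auto
  then have "packing_measure q (A \<inter> K) + packing_measure q (A - K)
      \<le> packing_measure q A + ennreal C * 0"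
    by (rule tendsto_lowerbound) (auto intro!: always_eventually le)
  then show ?thesis by simp
qed simp

text \<open>Caratheodory's theorem gives a measure on \<open>lambda_system\<close>, the measurable
  sets of the outer measure. These contain the closed sets, hence the Borel sets they
  generate.\<close>

lemma measure_space_packing_measure: "measure_space UNIV (sets borel) (packing_measure q)"
proof -
  interpret sigma_algebra UNIV "UNIV :: 'a set set" using sigma_algebra_Pow[of UNIV] by simp
  define L where "L = lambda_system UNIV UNIV (packing_measure q)"
  have L: "measure_space UNIV L (packing_measure q)"
    unfolding L_def by (rule caratheodory_lemma[OF outer_measure_packing_measure])
  have "K \<in> L" if K: "closed K" for K
    unfolding L_def lambda_system_eq
  proof (intro CollectI conjI ballI antisym caratheodory_closed[OF K] UNIV_I)
    fix A
    show "packing_measure q A \<le> packing_measure q (A \<inter> K) + packing_measure q (A - K)"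
      using packing_measure_Un_le[of "A \<inter> K" "A - K"] by (simp add: Int_Diff_Un)
  qed
  then have "sigma_sets UNIV (Collect closed) \<subseteq> L"
    using L by (intro sigma_algebra.sigma_sets_subset) (auto simp: measure_space_def)
  then have sub: "sets borel \<subseteq> L" by (simp add: borel_eq_closed)
  have "countably_additive (sets borel) (packing_measure q)"
    using L sub unfolding measure_space_def countably_additive_def by (meson order_trans subsetD)
  moreover have "sigma_algebra UNIV (sets borel :: 'a set set)"
    using sets.sigma_algebra_axioms[of borel] by simp
  ultimately show ?thesis
    by (simp add: measure_space_def positive_def packing_measure_empty)
qed

text \<open>\<open>measure_of\<close> falls back to the zero measure unless its argument is a
  measure on the sigma algebra, so countable additivity on Borel sets has to come first.\<close>

lemma emeasure_borel_restriction:
  "A \<in> sets borel \<Longrightarrow> emeasure (borel_restriction (packing_measure q)) A = packing_measure q A"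
  unfolding borel_restriction_def using measure_space_packing_measure
  by (intro emeasure_measure_of_sigma) (auto simp: measure_space_def)

lemma packing_measure_ge: 
  assumes "A \<in> sets borel"
  shows "ennreal c * emeasure \<mu> A \<le> packing_measure q A"
  unfolding packing_measure_def
proof (rule INF_greatest)
  fix U assume U: "U \<in> {U. open U \<and> A \<subseteq> U}"
  then have "ennreal c * emeasure \<mu> A \<le> ennreal c * emeasure \<mu> U"
    by (intro mult_left_mono emeasure_mono) (auto simp: sets_borel)
  also have "\<dots> \<le> packing_open q U" using U by (intro lower) auto
  finally show "ennreal c * emeasure \<mu> A \<le> packing_open q U" .
qed

lemma packing_measure_le:
  "packing_measure q A \<le> ennreal C * (INF U\<in>{U. open U \<and> A \<subseteq> U}. emeasure \<mu> U)"
proof -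
  have inv: "ennreal (1 / C) * (ennreal C * x) = x" "ennreal C * (ennreal (1 / C) * x) = x" for x
    using pos by (simp_all add: mult.assoc[symmetric] flip: ennreal_mult')
  \<comment> \<open>Dividing by \<open>C\<close> first leaves a plain lower bound for the infimum;
    multiplying back restores the constant.\<close>
  have "ennreal (1 / C) * packing_measure q A \<le> (INF U\<in>{U. open U \<and> A \<subseteq> U}. emeasure \<mu> U)"
  proof (rule INF_greatest)
    fix U assume "U \<in> {U. open U \<and> A \<subseteq> U}"
    then have "packing_measure q A \<le> ennreal C * emeasure \<mu> U"
      using packing_measure_mono[of A U q] packing_measure_open[of U q] packing_open_le[of U]
      by simp
    then have "ennreal (1 / C) * packing_measure q A \<le> ennreal (1 / C) * (ennreal C * emeasure \<mu> U)"
      by (rule mult_left_mono) simp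
    then show "ennreal (1 / C) * packing_measure q A \<le> emeasure \<mu> U" by (simp only: inv)
  qed
  then have "ennreal C * (ennreal (1 / C) * packing_measure q A)
      \<le> ennreal C * (INF U\<in>{U. open U \<and> A \<subseteq> U}. emeasure \<mu> U)"
    by (rule mult_left_mono) simp
  then show ?thesis by (simp only: inv)
qed

end

section \<open>Equivalence of the packing measure with the given measure\<close>

theorem theorem3p1:
  fixes \<nu> \<mu> :: "'a::metric_space measure"
    and q :: "'a set \<Rightarrow> ennreal"
    and \<alpha> \<gamma> C r\<^sub>0 :: real
  assumes "separable_space (euclidean :: 'a topology)"
    and "directionally_limited TYPE('a)"
    and "0 < \<alpha>" "\<alpha> \<le> 1" "1 \<le> \<gamma>"
    and "asymptotically_bounded_measure \<alpha> \<gamma> \<nu>"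
    and "sets \<mu> = sets borel"
    and "premeasure q"
    and "1 \<le> C" "0 < r\<^sub>0"
    and "\<And>x r. 0 < r \<Longrightarrow> r < r\<^sub>0 \<Longrightarrow>
           ennreal (1 / C) * emeasure \<mu> (cball x (\<alpha> * r)) \<le> q (cball x r) \<and>
           q (cball x r) \<le> ennreal C * emeasure \<mu> (cball x r)"
  shows "(\<forall>A\<in>sets borel.
            ennreal (1 / (\<gamma> * C)) * emeasure \<mu> A \<le> packing_measure q A \<and>
            packing_measure q A \<le> ennreal C * (INF U\<in>{U. open U \<and> A \<subseteq> U}. emeasure \<mu> U)) \<and>
         ((\<forall>A :: nat \<Rightarrow> 'a set. packing_measure q (\<Union>i. A i) \<le> (\<Sum>i. packing_measure q (A i))) \<and>
          metric_outer_measure (packing_measure q)) \<and>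
         (outer_regular_measure \<mu> \<longrightarrow>
            measure_space UNIV (sets borel) (packing_measure q) \<and>
            absolutely_continuous \<mu> (borel_restriction (packing_measure q)) \<and>
            absolutely_continuous (borel_restriction (packing_measure q)) \<mu> \<and>
            (\<forall>A\<in>sets borel.
               ennreal (1 / (\<gamma> * C)) * emeasure \<mu> A
                 \<le> emeasure (borel_restriction (packing_measure q)) A \<and>
               emeasure (borel_restriction (packing_measure q)) A \<le> ennreal C * emeasure \<mu> A))"
proof -
  obtain \<xi> \<eta> :: real and \<zeta> where dl:
    "directionally_limited_at \<xi> \<eta> \<zeta> (UNIV :: 'a set)" "\<eta> \<le> 1/3" "0 < \<xi>"
    using assms(2) unfolding directionally_limited_def by blast
  have c: "0 < 1 / (\<gamma> * C)" using assms(5,9) by simp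
  interpret comparable_premeasure \<mu> q C "1 / (\<gamma> * C)" r\<^sub>0
  proof
    fix U :: "'a set" assume "open U"
    then show "ennreal (1 / (\<gamma> * C)) * emeasure \<mu> U \<le> packing_open q U"
      using measure_le_packing_open[OF assms(1) dl assms(3-7,9,10)] assms(11) by blast
  qed (use assms c in auto)
  have sets: "sets (borel_restriction (packing_measure q)) = sets borel"
    unfolding borel_restriction_def using sets.sigma_sets_eq[of "borel :: 'a measure"] by simp
  \<comment> \<open>Outer regularity identifies the infimum over open supersets with the measure of
    \<open>A\<close>. The two bounds have positive finite constants, so both measures have the same
    null sets.\<close>
  have bounds: "ennreal (1 / (\<gamma> * C)) * emeasure \<mu> A \<le> emeasure (borel_restriction (packing_measure q)) A \<and>
      emeasure (borel_restriction (packing_measure q)) A \<le> ennreal C * emeasure \<mu> A"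
    if "outer_regular_measure \<mu>" "A \<in> sets borel" for A
    using that packing_measure_ge[OF that(2)] packing_measure_le[of A]
    by (simp add: emeasure_borel_restriction outer_regular_measure_def)
  have "absolutely_continuous \<mu> (borel_restriction (packing_measure q))"
    if "outer_regular_measure \<mu>"
    unfolding absolutely_continuous_def
  proof
    fix A assume "A \<in> null_sets \<mu>"
    then show "A \<in> null_sets (borel_restriction (packing_measure q))"
      using bounds[OF that, of A] by (auto simp: null_sets_def sets sets_borel)
  qed
  moreover have "absolutely_continuous (borel_restriction (packing_measure q)) \<mu>"
    if "outer_regular_measure \<mu>"
    unfolding absolutely_continuous_def
  proof
    fix A assume "A \<in> null_sets (borel_restriction (packing_measure q))"
    then show "A \<in> null_sets \<mu>"
      using bounds[OF that, of A] c by (auto simp: null_sets_def sets sets_borel)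
  qed
  ultimately show ?thesis
    using packing_measure_ge packing_measure_le packing_measure_UN_le
      metric_outer_measure_packing_measure measure_space_packing_measure bounds
    by blast
qed

end
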